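(* Let $A\in\mathbb{F}^{n\times n}$ be nonsingular and let $Q\in\mathbb{F}^{n\times n}$ be Hermitian positive definite. Suppose that $f$ is a continuous map from $\mathbb{P}^{n\times n}$ into itself. Let $\{(A^{(k)},B^{(k)},Q^{(k)})\}_{k\ge1}$ be the sequence defined in the context. Then the following statements hold. (1) $Q^{(\infty)}:=\lim_{\ell\to\infty}Q^{(\ell)}$ is the maximal positive definite solution of $X-A^{H}f(X)^{-1}A=Q$. (2) $Q-B^{(\infty)}$, where $B^{(\infty)}:=\lim_{\ell\to\infty}B^{(\ell)}$, is the maximal positive definite solution of the dual equation $\widetilde X=Q+f(A)f(\widetilde X)^{-1}f(A)^{H}$. (3) $B^{(\infty)}$ is the minimal negative definite solution of $X-A^{H}f(X)^{-1}A=Q$.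
   Context: $\mathbb{F}$ is $\mathbb{R}$ or $\mathbb{C}$; $M^H$ is the conjugate transpose of $M$; for Hermitian matrices, $X>Y$ ($X\ge Y$) means $X-Y$ is positive definite (positive semidefinite). $\mathbb{P}^{n\times n}$ is the set of positive definite matrices in $\mathbb{F}^{n\times n}$. The map $f:\mathbb{F}^{n\times n}\to\mathbb{F}^{n\times n}$ satisfies, for all $M,N\in\mathbb{F}^{n\times n}$: (a1) $f(f(M))=M$; (a2) $f(M+N)=f(M)+f(N)$; (a3) $f(MN)=f(M)f(N)$; (a4) $f(M)\ge0$ whenever $M\ge 0$. Sequence: $A^{(1)}:=f(A)f(Q)^{-1}A$, $B^{(1)}:=-f(A)f(Q)^{-1}f(A)^H$, $Q^{(1)}:=Q+A^Hf(Q)^{-1}A$, and for $k>1$: $A^{(k)}:=A^{(1)}(Q^{(1)}-B^{(k-1)})^{-1}A^{(k-1)}$, $B^{(k)}:=B^{(1)}+A^{(1)}(Q^{(1)}-B^{(k-1)})^{-1}(A^{(1)})^H$, $Q^{(k)}:=Q^{(k-1)}-(A^{(k-1)})^H(Q^{(1)}-B^{(k-1)})^{-1}A^{(k-1)}$. A positive definite (respectively negative definite) solution $X_M$ of an equation is called maximal (respectively minimal) if $X_M\ge X$ (respectively $X_M\le X$) for every Hermitian solution $X$ of that equation. *)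

theory Defs
  imports "HOL-Analysis.Analysis"
begin

(* The scalar field, real or complex, with its conjugation; field_conj_cases below shows
   that the axioms admit no other field. *)
class real_or_complex = real_normed_field +
  fixes field_conj :: "'a \<Rightarrow> 'a"
  assumes field_conj_add: "field_conj (x + y) = field_conj x + field_conj y"
    and field_conj_mult: "field_conj (x * y) = field_conj x * field_conj y"
    and field_conj_conj: "field_conj (field_conj x) = x"
    and mult_field_conj_scaleR: "x * field_conj x = (norm x)\<^sup>2 *\<^sub>R 1"
    and field_conj_fixed_scaleR: "field_conj x = x \<Longrightarrow> \<exists>r. x = r *\<^sub>R 1"

instantiation real :: real_or_complex
begin
definition field_conj_real :: "real \<Rightarrow> real" where "field_conj_real x = x"
instance
  by standard (simp_all add: field_conj_real_def power2_eq_square Reals_def)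
end

instantiation complex :: real_or_complex
begin
definition field_conj_complex :: "complex \<Rightarrow> complex" where "field_conj_complex z = cnj z"
instance
proof
  fix x y :: complex
  show "x * field_conj x = (norm x)\<^sup>2 *\<^sub>R 1"
    unfolding field_conj_complex_def by (simp add: complex_norm_square[symmetric] scaleR_conv_of_real)
  show "\<exists>r. x = r *\<^sub>R 1" if "field_conj x = x"
    using that by (intro exI[of _ "Re x"]) (auto simp: field_conj_complex_def complex_eq_iff)
qed (simp_all add: field_conj_complex_def)
end

lemma mult_field_conj: "x * field_conj x = of_real ((norm (x::'a::real_or_complex))\<^sup>2)"
  unfolding of_real_def by (rule mult_field_conj_scaleR)

lemma field_conj_fixed: "field_conj x = x \<Longrightarrow> (x::'a::real_or_complex) \<in> \<real>"
  using field_conj_fixed_scaleR[of x] by (auto simp: Reals_def of_real_def)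

lemma field_conj_of_real: "field_conj (of_real r :: 'a::real_or_complex) = of_real r"
proof (cases "r = 0")
  case True
  then show ?thesis using field_conj_add[of "0::'a" 0] by simp
next
  case False
  then show ?thesis using mult_field_conj[of "of_real r :: 'a"]
    by (simp add: power2_eq_square)
qed

lemma field_conj_minus: "field_conj (- x) = - field_conj (x::'a::real_or_complex)"
  using field_conj_mult[of "of_real (-1)" x] field_conj_of_real[of "-1", where 'a='a] by simp

lemma field_conj_cases:
  "(\<forall>z::'a::real_or_complex. z \<in> \<real> \<and> field_conj z = z) \<or>
   (\<exists>i::'a. i * i = -1 \<and> field_conj i = - i \<and> (\<forall>z. \<exists>a b. z = of_real a + of_real b * i))"
proof (cases "\<forall>z::'a. field_conj z = z")
  case True
  then show ?thesis using field_conj_fixed by blast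
next
  case False
  then obtain w :: 'a where w: "field_conj w \<noteq> w" by blast
  define u where "u = w - field_conj w"
  have u0: "u \<noteq> 0" using w by (simp add: u_def)
  have diff: "field_conj (x - y) = field_conj x - field_conj y" for x y :: 'a
    using field_conj_add[of x "- y"] by (simp add: field_conj_minus)
  have cu: "field_conj u = - u" by (simp add: u_def diff field_conj_conj)
  define i where "i = of_real (inverse (norm u)) * u"
  have ci: "field_conj i = - i" unfolding i_def
    by (simp only: field_conj_mult field_conj_of_real cu mult_minus_right)
  have "norm i = 1" using u0 by (simp add: i_def norm_mult norm_inverse)
  then have "i * - i = 1" using mult_field_conj[of i] by (simp only: ci) simp
  then have "- (i * i) = - (-1)" by simp
  then have ii: "i * i = -1" by (simp only: neg_equal_iff_equal)
  have "\<exists>a b. z = of_real a + of_real b * i" for z :: 'a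
  proof -
    have "field_conj (z + field_conj z) = z + field_conj z"
      by (simp add: field_conj_add field_conj_conj add.commute)
    from field_conj_fixed[OF this] obtain a where a: "z + field_conj z = of_real a"
      by (rule Reals_cases)
    have "field_conj ((z - field_conj z) * i) = (z - field_conj z) * i"
      by (simp add: field_conj_mult diff field_conj_conj ci algebra_simps)
    from field_conj_fixed[OF this] obtain b where b: "(z - field_conj z) * i = of_real b"
      by (rule Reals_cases)
    have "- ((z - field_conj z) * i) * i = - ((z - field_conj z) * (i * i))"
      by (simp only: mult.assoc mult_minus_left)
    then have c: "z - field_conj z = - of_real b * i"
      unfolding b ii by simp
    have "z + z = of_real a + - of_real b * i"
      using arg_cong2[where f="(+)", OF a c] by simp
    then have "2 * z = 2 * (of_real (a / 2) + of_real (- b / 2) * i)"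
      by (simp add: mult_2 [symmetric] distrib_left)
    then have "z = of_real (a / 2) + of_real (- b / 2) * i"
      by (simp only: mult_cancel_left) simp
    then show ?thesis by blast
  qed
  then show ?thesis using ii ci by blast
qed

definition conj_transpose :: "'a::real_or_complex ^ 'n ^ 'm \<Rightarrow> 'a ^ 'm ^ 'n"
    (\<open>_\<^sup>H\<close> [1000] 999)
  where "M\<^sup>H = (\<chi> i j. field_conj (M $ j $ i))"

definition hermitian :: "'a::real_or_complex ^ 'n ^ 'n \<Rightarrow> bool"
  where "hermitian M \<longleftrightarrow> M\<^sup>H = M"

definition quad_form :: "'a::real_or_complex ^ 'n ^ 'n \<Rightarrow> 'a ^ 'n \<Rightarrow> 'a"
  where "quad_form M x = (\<Sum>i\<in>UNIV. field_conj (x $ i) * (M *v x) $ i)"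

(* The scalar field carries no order, so "quad_form M x > 0" is spelled out as
   "quad_form M x is a positive real". *)
definition pos_def :: "'a::real_or_complex ^ 'n ^ 'n \<Rightarrow> bool"
  where "pos_def M \<longleftrightarrow>
    hermitian M \<and> (\<forall>x. x \<noteq> 0 \<longrightarrow> (\<exists>r>0. quad_form M x = of_real r))"

definition pos_semidef :: "'a::real_or_complex ^ 'n ^ 'n \<Rightarrow> bool"
  where "pos_semidef M \<longleftrightarrow>
    hermitian M \<and> (\<forall>x. \<exists>r\<ge>0. quad_form M x = of_real r)"

definition neg_def :: "'a::real_or_complex ^ 'n ^ 'n \<Rightarrow> bool"
  where "neg_def M \<longleftrightarrow> pos_def (- M)"

definition loewner_le :: "'a::real_or_complex ^ 'n ^ 'n \<Rightarrow> 'a ^ 'n ^ 'n \<Rightarrow> bool"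
    (infix \<open>\<le>\<^sub>L\<close> 50)
  where "X \<le>\<^sub>L Y \<longleftrightarrow> pos_semidef (Y - X)"

(* matrix_inv is unspecified on singular matrices, hence the explicit invertibility
   requirement in the two solution predicates. *)
definition is_solution ::
    "('a::real_or_complex ^ 'n ^ 'n \<Rightarrow> 'a ^ 'n ^ 'n) \<Rightarrow> 'a ^ 'n ^ 'n \<Rightarrow> 'a ^ 'n ^ 'n \<Rightarrow>
      'a ^ 'n ^ 'n \<Rightarrow> bool"
  where "is_solution f A Q X \<longleftrightarrow>
    invertible (f X) \<and> X - A\<^sup>H ** matrix_inv (f X) ** A = Q"

definition is_dual_solution ::
    "('a::real_or_complex ^ 'n ^ 'n \<Rightarrow> 'a ^ 'n ^ 'n) \<Rightarrow> 'a ^ 'n ^ 'n \<Rightarrow> 'a ^ 'n ^ 'n \<Rightarrow>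
      'a ^ 'n ^ 'n \<Rightarrow> bool"
  where "is_dual_solution f A Q X \<longleftrightarrow>
    invertible (f X) \<and> X = Q + f A ** matrix_inv (f X) ** (f A)\<^sup>H"

definition maximal_pos_def_solution ::
    "('a::real_or_complex ^ 'n ^ 'n \<Rightarrow> bool) \<Rightarrow> 'a ^ 'n ^ 'n \<Rightarrow> bool"
  where "maximal_pos_def_solution S X\<^sub>M \<longleftrightarrow>
    pos_def X\<^sub>M \<and> S X\<^sub>M \<and> (\<forall>X. hermitian X \<and> S X \<longrightarrow> X \<le>\<^sub>L X\<^sub>M)"

definition minimal_neg_def_solution ::
    "('a::real_or_complex ^ 'n ^ 'n \<Rightarrow> bool) \<Rightarrow> 'a ^ 'n ^ 'n \<Rightarrow> bool"
  where "minimal_neg_def_solution S X\<^sub>M \<longleftrightarrow>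
    neg_def X\<^sub>M \<and> S X\<^sub>M \<and> (\<forall>X. hermitian X \<and> S X \<longrightarrow> X\<^sub>M \<le>\<^sub>L X)"

end

theory Submission
  imports Defs
begin

text \<open>
Put \<open>\<phi> X = Q + A\<^sup>H f(X)\<^sup>-\<^sup>1 A\<close>. The solutions of the equation are the fixed points of \<open>\<phi>\<close>.

On positive definite matrices \<open>\<phi>\<close> reverses the Loewner order, because inversion does and \<open>f\<close> and
congruences preserve it. Started at \<open>Q\<close>, the even iterates of \<open>\<phi>\<close> therefore increase, the odd ones
decrease, and the even ones stay below the odd ones. The constant summand \<open>Q\<close> makes \<open>\<phi>\<close> a contraction
for the relative gap: if \<open>(1 - s) X \<le> Y\<close>, then \<open>(1 - s (1 - a)) \<phi>(Y) \<le> \<phi>(X)\<close> for a constant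
\<open>a > 0\<close> (\<open>\<phi>_contraction\<close>). So both halves of the iteration have the same limit, and the squeeze
makes it a positive definite fixed point (\<open>odd_iterate_converges\<close>). This limit \<open>P\<close> dominates every
Hermitian solution \<open>X\<close>, indefinite ones included (\<open>hermitian_solution_le\<close>): the form of
\<open>D = P - X\<close> satisfies \<open>D(x) \<le> D(U x)\<close> for an invertible \<open>U\<close> that is strictly expanding for the form
of \<open>D P\<^sup>-\<^sup>1 D\<close>, and this form controls \<open>D\<close>; going backwards along \<open>U\<close> shows \<open>D \<ge> 0\<close>.

The recurrence computes these iterates. By the Woodbury identity \<open>\<phi> \<circ> \<phi>\<close> is the matrix Moebius map
\<open>X \<mapsto> Q\<^sub>1 - A\<^sub>1\<^sup>H (X - B\<^sub>1)\<^sup>-\<^sup>1 A\<^sub>1\<close> (\<open>\<phi>_\<phi>\<close>), and the \<open>k\<close>-th terms of the three sequences are the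
coefficients of its \<open>k\<close>-th power (\<open>funpow_\<phi>_\<phi>_eq\<close>). Evaluated at \<open>\<phi>(Q)\<close> this identifies the
\<open>Q\<close>-sequence with the odd iterates. The dual equation is the same equation with \<open>f(A)\<^sup>H\<close> in place of
\<open>A\<close>, and \<open>Q\<close> minus the \<open>B\<close>-sequence is its sequence of odd iterates (\<open>dual_odd_iterate_eq\<close>), so the
second claim is an instance of the first. Finally \<open>X \<mapsto> Q - X\<close> exchanges the Hermitian solutions of
the two equations (\<open>dual_solution\<close>) and reverses the order, which gives the third claim.

Two properties of \<open>f\<close> have to be extracted from its ring axioms and its positivity: it is homogeneous
for real factors on positive semidefinite matrices (\<open>f_scaleR_pos_semidef\<close>), and it commutes with the
conjugate transpose (\<open>f_conj_transpose\<close>).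
\<close>

section \<open>Real parts of scalars\<close>

text \<open>
The scalar class has no real part of its own. The value \<open>(z + field_conj z) / 2\<close> is fixed by
conjugation, hence real, so the description has exactly one witness.
\<close>

definition real_part :: "'a::real_or_complex \<Rightarrow> real"
  where "real_part z = (THE r. of_real r = (z + field_conj z) / 2)"

lemma field_conj_zero [simp]: "field_conj (0::'a::real_or_complex) = 0"
  using field_conj_of_real[of 0, where 'a='a] by simp

lemma field_conj_one [simp]: "field_conj (1::'a::real_or_complex) = 1"
  using field_conj_of_real[of 1, where 'a='a] by simp

lemma field_conj_diff: "field_conj (x - y) = field_conj x - field_conj (y::'a::real_or_complex)"
  using field_conj_add[of x "- y"] by (simp add: field_conj_minus)

lemma field_conj_sum: "field_conj (sum g S) = (\<Sum>i\<in>S. field_conj (g i :: 'a::real_or_complex))"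
  by (induction S rule: infinite_finite_induct) (simp_all add: field_conj_add)

lemma field_conj_scaleR: "field_conj (r *\<^sub>R x) = r *\<^sub>R field_conj (x::'a::real_or_complex)"
  by (simp add: scaleR_conv_of_real field_conj_mult field_conj_of_real)

lemma norm_field_conj [simp]: "norm (field_conj x) = norm (x::'a::real_or_complex)"
proof (cases "x = 0")
  case False
  have "norm x * norm (field_conj x) = norm x * norm x"
    using arg_cong[OF mult_field_conj[of x], of norm]
    by (simp add: norm_mult power2_eq_square)
  with False show ?thesis by simp
qed simp

lemma of_real_real_part: "of_real (real_part z) = (z + field_conj z) / (2::'a::real_or_complex)"
proof -
  have "field_conj (z + field_conj z) = z + field_conj z"
    by (simp add: field_conj_add field_conj_conj add.commute)
  then have "z + field_conj z \<in> \<real>" by (rule field_conj_fixed)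
  then have "(z + field_conj z) / 2 \<in> \<real>" by simp
  then obtain r where r: "(z + field_conj z) / 2 = of_real r" by (auto elim: Reals_cases)
  then have "real_part z = r" unfolding real_part_def by (intro the_equality) auto
  with r show ?thesis by simp
qed

lemma real_part_of_real [simp]: "real_part (of_real r :: 'a::real_or_complex) = r"
proof -
  have "(of_real (real_part (of_real r :: 'a)) :: 'a) = of_real r"
    by (simp add: of_real_real_part field_conj_of_real)
  then show ?thesis by (simp only: of_real_eq_iff)
qed

lemma real_part_add: "real_part (x + y) = real_part x + real_part (y::'a::real_or_complex)"
proof -
  have "(of_real (real_part (x + y)) :: 'a) = of_real (real_part x + real_part y)"
    by (simp add: of_real_real_part field_conj_add add_divide_distrib[symmetric] algebra_simps)
  then show ?thesis by (simp only: of_real_eq_iff)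
qed

lemma real_part_zero [simp]: "real_part (0::'a::real_or_complex) = 0"
  using real_part_of_real[of 0, where 'a='a] by simp

lemma real_part_minus: "real_part (- x) = - real_part (x::'a::real_or_complex)"
  using real_part_add[of x "- x"] by simp

lemma real_part_diff: "real_part (x - y) = real_part x - real_part (y::'a::real_or_complex)"
  using real_part_add[of x "- y"] by (simp add: real_part_minus)

lemma real_part_sum: "real_part (sum g S) = (\<Sum>i\<in>S. real_part (g i :: 'a::real_or_complex))"
  by (induction S rule: infinite_finite_induct) (simp_all add: real_part_add)

lemma real_part_scaleR: "real_part (r *\<^sub>R x) = r * real_part (x::'a::real_or_complex)"
proof -
  have "(of_real (real_part (r *\<^sub>R x)) :: 'a) = of_real (r * real_part x)"
    by (simp add: of_real_real_part field_conj_scaleR scaleR_conv_of_real field_conj_mult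
        field_conj_of_real distrib_left)
  then show ?thesis by (simp only: of_real_eq_iff)
qed

lemma abs_real_part_le_norm: "\<bar>real_part x\<bar> \<le> norm (x::'a::real_or_complex)"
proof -
  have "\<bar>real_part x\<bar> = norm (of_real (real_part x) :: 'a)" by simp
  also have "\<dots> \<le> (norm x + norm (field_conj x)) / 2"
    by (simp only: of_real_real_part norm_divide) (simp add: norm_triangle_ineq[THEN order_trans])
  finally show ?thesis by simp
qed

section \<open>Matrix algebra and conjugate transposes\<close>

lemma matrix_add_rdistrib: "(A + B) ** C = A ** C + B ** (C::'a::real_or_complex^'n^'m)"
  by (vector matrix_matrix_mult_def sum.distrib[symmetric] distrib_right)

lemma matrix_diff_ldistrib: "A ** (B - C) = A ** B - A ** (C::'a::real_or_complex^'n^'m)"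
  by (vector matrix_matrix_mult_def sum_subtractf[symmetric] right_diff_distrib)

lemma matrix_diff_rdistrib: "(A - B) ** C = A ** C - B ** (C::'a::real_or_complex^'n^'m)"
  by (vector matrix_matrix_mult_def sum_subtractf[symmetric] left_diff_distrib)

lemma matrix_minus_left: "(- A) ** C = - (A ** (C::'a::real_or_complex^'n^'m))"
  by (vector matrix_matrix_mult_def sum_negf[symmetric])

lemma matrix_minus_right: "A ** (- C) = - (A ** (C::'a::real_or_complex^'n^'m))"
  by (vector matrix_matrix_mult_def sum_negf[symmetric])

lemma matrix_scaleR_left: "(r *\<^sub>R A) ** C = r *\<^sub>R (A ** (C::'a::real_or_complex^'n^'m))"
  by (vector matrix_matrix_mult_def scaleR_sum_right)

lemma matrix_scaleR_right: "A ** (r *\<^sub>R C) = r *\<^sub>R (A ** (C::'a::real_or_complex^'n^'m))"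
  by (vector matrix_matrix_mult_def scaleR_sum_right)

lemmas matrix_distribs = matrix_add_ldistrib matrix_add_rdistrib matrix_diff_ldistrib
  matrix_diff_rdistrib matrix_minus_left matrix_minus_right matrix_scaleR_left matrix_scaleR_right

lemma matrix_inv_cancel:
  fixes A :: "'a::real_or_complex^'n^'n"
  assumes "invertible A"
  shows "A ** matrix_inv A = mat 1" "matrix_inv A ** A = mat 1"
    "A ** (matrix_inv A ** C) = C" "matrix_inv A ** (A ** C) = C"
proof -
  have "A ** matrix_inv A = mat 1 \<and> matrix_inv A ** A = mat 1"
    using assms unfolding invertible_def matrix_inv_def by (rule someI_ex)
  then show "A ** matrix_inv A = mat 1" "matrix_inv A ** A = mat 1"
    "A ** (matrix_inv A ** C) = C" "matrix_inv A ** (A ** C) = C"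
    by (simp_all add: matrix_mul_assoc)
qed

lemma invertibleI: "A ** B = mat 1 \<Longrightarrow> invertible (A::'a::real_or_complex^'n^'n)"
  using invertible_right_inverse by blast

lemma matrix_inv_unique:
  fixes A :: "'a::real_or_complex^'n^'n"
  assumes "A ** B = mat 1"
  shows "matrix_inv A = B"
proof -
  have "matrix_inv A = matrix_inv A ** (A ** B)" using assms by simp
  also have "\<dots> = B" by (rule matrix_inv_cancel(4)[OF invertibleI[OF assms]])
  finally show ?thesis .
qed

lemma invertible_matrix_inv: "invertible A \<Longrightarrow> invertible (matrix_inv (A::'a::real_or_complex^'n^'n))"
  using matrix_inv_cancel(2) invertibleI by blast

lemma matrix_inv_inv: "invertible A \<Longrightarrow> matrix_inv (matrix_inv A) = (A::'a::real_or_complex^'n^'n)"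
  using matrix_inv_cancel(2) matrix_inv_unique by blast

lemma matrix_inv_scaleR:
  fixes A :: "'a::real_or_complex^'n^'n"
  assumes "invertible A" "r \<noteq> 0"
  shows "matrix_inv (r *\<^sub>R A) = inverse r *\<^sub>R matrix_inv A"
  by (intro matrix_inv_unique) (simp add: matrix_distribs matrix_inv_cancel assms)

lemma conj_transpose_nth [simp]: "M\<^sup>H $ i $ j = field_conj (M $ j $ i)"
  by (simp add: conj_transpose_def)

lemma conj_transpose_conj_transpose [simp]: "(M\<^sup>H)\<^sup>H = M"
  by (simp add: vec_eq_iff field_conj_conj)

lemma conj_transpose_add: "(M + N)\<^sup>H = M\<^sup>H + N\<^sup>H"
  by (simp add: vec_eq_iff field_conj_add)

lemma conj_transpose_diff: "(M - N)\<^sup>H = M\<^sup>H - N\<^sup>H"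
  by (simp add: vec_eq_iff field_conj_diff)

lemma conj_transpose_minus: "(- M)\<^sup>H = - (M\<^sup>H)"
  by (simp add: vec_eq_iff field_conj_minus)

lemma conj_transpose_scaleR: "(r *\<^sub>R M)\<^sup>H = r *\<^sub>R M\<^sup>H"
  by (simp add: vec_eq_iff field_conj_scaleR)

lemma conj_transpose_mult: "(M ** N)\<^sup>H = N\<^sup>H ** M\<^sup>H"
  by (simp add: vec_eq_iff matrix_matrix_mult_def field_conj_sum field_conj_mult mult.commute)

lemma conj_transpose_mat_1 [simp]: "(mat 1)\<^sup>H = mat 1"
  by (simp add: vec_eq_iff mat_def)

lemma conj_transpose_zero [simp]: "0\<^sup>H = 0"
  by (simp add: vec_eq_iff)

lemma invertible_conj_transpose:
  fixes M :: "'a::real_or_complex^'n^'n"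
  assumes "invertible M" shows "invertible (M\<^sup>H)"
  by (rule invertibleI[of _ "(matrix_inv M)\<^sup>H"])
     (simp add: conj_transpose_mult[symmetric] matrix_inv_cancel assms)

lemma matrix_inv_conj_transpose:
  fixes M :: "'a::real_or_complex^'n^'n"
  assumes "invertible M" shows "matrix_inv (M\<^sup>H) = (matrix_inv M)\<^sup>H"
  by (rule matrix_inv_unique)
     (simp add: conj_transpose_mult[symmetric] matrix_inv_cancel assms)

lemmas conj_transpose_simps = conj_transpose_add conj_transpose_diff conj_transpose_minus
  conj_transpose_scaleR conj_transpose_mult

section \<open>Quadratic forms and the Loewner order\<close>

definition cinner :: "'a::real_or_complex^'n \<Rightarrow> 'a^'n \<Rightarrow> 'a"
  where "cinner x y = (\<Sum>i\<in>UNIV. field_conj (x $ i) * y $ i)"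

text \<open>
A real-valued version of the quadratic form, total and linear in the matrix, so that comparisons in
the Loewner order become inequalities between reals. On a Hermitian matrix it is the quadratic form.
\<close>

definition rform :: "'a::real_or_complex^'n^'n \<Rightarrow> 'a^'n \<Rightarrow> real"
  where "rform M x = real_part (quad_form M x)"

lemma quad_form_cinner: "quad_form M x = cinner x (M *v x)"
  by (simp add: quad_form_def cinner_def)

lemma cinner_add_left: "cinner (x + y) z = cinner x z + cinner y z"
  by (simp add: cinner_def field_conj_add sum.distrib distrib_right)

lemma cinner_add_right: "cinner z (x + y) = cinner z x + cinner z y"
  by (simp add: cinner_def sum.distrib distrib_left)

lemma cinner_diff_right: "cinner z (x - y) = cinner z x - cinner z y"
  by (simp add: cinner_def sum_subtractf right_diff_distrib)

lemma cinner_scaleR_right: "cinner z (r *\<^sub>R x) = r *\<^sub>R cinner z x"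
  by (simp add: cinner_def scaleR_sum_right)

lemma field_conj_cinner: "field_conj (cinner x y) = cinner y x"
  by (simp add: cinner_def field_conj_sum field_conj_mult field_conj_conj mult.commute)

lemma cinner_adjoint: "cinner x (M *v y) = cinner (M\<^sup>H *v x) y"
proof -
  have "cinner x (M *v y) = (\<Sum>i\<in>UNIV. \<Sum>j\<in>UNIV. field_conj (x $ i) * (M $ i $ j * y $ j))"
    by (simp add: cinner_def matrix_vector_mult_def sum_distrib_left)
  also have "\<dots> = (\<Sum>j\<in>UNIV. \<Sum>i\<in>UNIV. field_conj (x $ i) * (M $ i $ j * y $ j))"
    by (rule sum.swap)
  also have "\<dots> = cinner (M\<^sup>H *v x) y"
    by (simp add: cinner_def matrix_vector_mult_def field_conj_sum sum_distrib_right
        sum_distrib_left field_conj_mult field_conj_conj mult_ac)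
  finally show ?thesis .
qed

lemma rform_add: "rform (M + N) x = rform M x + rform N x"
  by (simp add: rform_def quad_form_cinner matrix_vector_mult_add_rdistrib cinner_add_right
      real_part_add)

lemma rform_diff: "rform (M - N) x = rform M x - rform N x"
  by (simp add: rform_def quad_form_cinner matrix_vector_mult_diff_rdistrib cinner_diff_right
      real_part_diff)

lemma rform_zero [simp]: "rform 0 x = 0"
  by (simp add: rform_def quad_form_cinner cinner_def)

lemma rform_scaleR: "rform (r *\<^sub>R M) x = r * rform M x"
proof -
  have "(r *\<^sub>R M) *v x = r *\<^sub>R (M *v x)"
    by (simp add: vec_eq_iff matrix_vector_mult_def scaleR_sum_right)
  then show ?thesis
    by (simp add: rform_def quad_form_cinner cinner_scaleR_right real_part_scaleR)
qed

lemma rform_zero_right [simp]: "rform M 0 = 0"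
  by (simp add: rform_def quad_form_cinner cinner_def)

lemma rform_congruence: "rform (N\<^sup>H ** M ** N) x = rform M (N *v x)"
proof -
  have "cinner x ((N\<^sup>H ** M ** N) *v x) = cinner x (N\<^sup>H *v (M *v (N *v x)))"
    by (simp add: matrix_vector_mul_assoc matrix_mul_assoc)
  also have "\<dots> = cinner (N *v x) (M *v (N *v x))"
    by (subst cinner_adjoint) simp
  finally show ?thesis by (simp add: rform_def quad_form_cinner)
qed

lemmas rform_simps = rform_add rform_diff rform_scaleR

lemma quad_form_hermitian:
  assumes "hermitian M" shows "quad_form M x = of_real (rform M x)"
proof -
  have "field_conj (quad_form M x) = quad_form M x"
    using assms unfolding quad_form_cinner hermitian_def
    by (subst field_conj_cinner) (subst cinner_adjoint, simp)
  then show ?thesis by (simp add: rform_def of_real_real_part)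
qed

lemma pos_semidef_iff: "pos_semidef M \<longleftrightarrow> hermitian M \<and> (\<forall>x. rform M x \<ge> 0)"
  unfolding pos_semidef_def by (auto simp: quad_form_hermitian)

lemma pos_def_iff: "pos_def M \<longleftrightarrow> hermitian M \<and> (\<forall>x. x \<noteq> 0 \<longrightarrow> rform M x > 0)"
  unfolding pos_def_def by (auto simp: quad_form_hermitian)

lemma hermitian_intros:
  "hermitian M \<Longrightarrow> hermitian N \<Longrightarrow> hermitian (M + N)"
  "hermitian M \<Longrightarrow> hermitian N \<Longrightarrow> hermitian (M - N)"
  "hermitian M \<Longrightarrow> hermitian (- M)"
  "hermitian M \<Longrightarrow> hermitian (r *\<^sub>R M)"
  "hermitian M \<Longrightarrow> hermitian (L\<^sup>H ** M ** L)"
  "hermitian (mat 1)"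
  by (simp_all add: hermitian_def conj_transpose_simps matrix_mul_assoc)

lemma hermitian_matrix_inv:
  fixes M :: "'a::real_or_complex^'n^'n"
  shows "hermitian M \<Longrightarrow> invertible M \<Longrightarrow> hermitian (matrix_inv M)"
  using matrix_inv_conj_transpose[of M] by (simp add: hermitian_def)

lemma loewner_le_iff:
  assumes "hermitian X" "hermitian Y"
  shows "X \<le>\<^sub>L Y \<longleftrightarrow> (\<forall>x. rform X x \<le> rform Y x)"
  using assms by (simp add: loewner_le_def pos_semidef_iff hermitian_intros rform_diff)

lemma loewner_leD: "X \<le>\<^sub>L Y \<Longrightarrow> rform X x \<le> rform Y x"
  by (simp add: loewner_le_def pos_semidef_iff rform_diff)

lemma loewner_le_refl [simp]: "X \<le>\<^sub>L X"
  by (simp add: loewner_le_def pos_semidef_iff hermitian_def)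

lemma loewner_le_trans: "X \<le>\<^sub>L Y \<Longrightarrow> Y \<le>\<^sub>L Z \<Longrightarrow> X \<le>\<^sub>L Z"
  using hermitian_intros(1)[of "Y - X" "Z - Y"]
  by (auto simp: loewner_le_def pos_semidef_iff rform_diff intro: order_trans)

lemma loewner_le_add_left: "X \<le>\<^sub>L Y \<Longrightarrow> Z + X \<le>\<^sub>L Z + Y"
  by (simp add: loewner_le_def)

lemma loewner_le_congruence:
  fixes X Y L :: "'a::real_or_complex^'n^'n"
  shows "X \<le>\<^sub>L Y \<Longrightarrow> L\<^sup>H ** X ** L \<le>\<^sub>L L\<^sup>H ** Y ** L"
  using hermitian_intros(5)[of "Y - X" L] rform_congruence[of L "Y - X"]
  by (simp add: loewner_le_def pos_semidef_iff rform_diff matrix_distribs)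

lemma pos_semidef_congruence:
  fixes M L :: "'a::real_or_complex^'n^'n"
  shows "pos_semidef M \<Longrightarrow> pos_semidef (L\<^sup>H ** M ** L)"
  by (simp add: pos_semidef_iff hermitian_intros rform_congruence)

lemma pos_def_imp_hermitian: "pos_def M \<Longrightarrow> hermitian M"
  by (simp add: pos_def_def)

lemma pos_def_imp_pos_semidef: "pos_def M \<Longrightarrow> pos_semidef M"
  unfolding pos_def_iff pos_semidef_iff
  by (metis order.refl order.strict_implies_order rform_zero_right)

lemma pos_def_imp_invertible:
  fixes M :: "'a::real_or_complex^'n^'n"
  assumes "pos_def M" shows "invertible M"
proof -
  have "x = 0" if "M *v x = 0" for x
  proof (rule ccontr)
    assume "x \<noteq> 0"
    with assms have "rform M x > 0" by (simp add: pos_def_iff)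
    with that show False by (simp add: rform_def quad_form_cinner cinner_def)
  qed
  then show ?thesis by (auto simp: invertible_left_inverse matrix_left_invertible_ker)
qed

lemma pos_def_congruence:
  fixes M L :: "'a::real_or_complex^'n^'n"
  assumes "pos_def M" "invertible L"
  shows "pos_def (L\<^sup>H ** M ** L)"
proof -
  have "L *v x \<noteq> 0" if "x \<noteq> 0" for x
    using that matrix_inv_cancel(2)[OF assms(2)]
    by (metis matrix_vector_mul_assoc matrix_vector_mul_lid matrix_vector_mult_0_right)
  with assms(1) show ?thesis
    by (simp add: pos_def_iff hermitian_intros rform_congruence)
qed

lemma pos_def_matrix_inv:
  fixes M :: "'a::real_or_complex^'n^'n"
  assumes "pos_def M" shows "pos_def (matrix_inv M)"
proof -
  note inv = pos_def_imp_invertible[OF assms]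
  have h: "hermitian (matrix_inv M)"
    by (rule hermitian_matrix_inv[OF pos_def_imp_hermitian[OF assms] inv])
  have "pos_def ((matrix_inv M)\<^sup>H ** M ** matrix_inv M)"
    by (rule pos_def_congruence[OF assms invertible_matrix_inv[OF inv]])
  then show ?thesis using h
    by (simp add: hermitian_def matrix_inv_cancel[OF inv])
qed

lemma pos_def_add_pos_semidef: "pos_def M \<Longrightarrow> pos_semidef N \<Longrightarrow> pos_def (M + N)"
  by (simp add: pos_def_iff pos_semidef_iff hermitian_intros rform_add add_pos_nonneg)

lemma pos_def_mono: "pos_def M \<Longrightarrow> M \<le>\<^sub>L N \<Longrightarrow> pos_def N"
  using pos_def_add_pos_semidef[of M "N - M"] by (simp add: loewner_le_def)

lemma pos_def_scaleR: "pos_def M \<Longrightarrow> r > 0 \<Longrightarrow> pos_def (r *\<^sub>R M)"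
  by (simp add: pos_def_iff hermitian_intros rform_scaleR)

text \<open>
With \<open>D = Y - X\<close>, substituting \<open>D\<close> twice into the resolvent identity gives
\<open>X\<^sup>-\<^sup>1 - Y\<^sup>-\<^sup>1 = Y\<^sup>-\<^sup>1 D Y\<^sup>-\<^sup>1 + (D Y\<^sup>-\<^sup>1)\<^sup>H X\<^sup>-\<^sup>1 (D Y\<^sup>-\<^sup>1)\<close>,
and both summands are congruent to positive semidefinite matrices.
\<close>

lemma loewner_le_matrix_inv:
  fixes X Y :: "'a::real_or_complex^'n^'n"
  assumes X: "pos_def X" and le: "X \<le>\<^sub>L Y"
  shows "matrix_inv Y \<le>\<^sub>L matrix_inv X"
proof -
  define D where "D = Y - X"
  have Y: "pos_def Y" using pos_def_mono[OF X le] .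
  note iX = pos_def_imp_invertible[OF X] and iY = pos_def_imp_invertible[OF Y]
  have hD: "D\<^sup>H = D" and D: "pos_semidef D"
    using le by (auto simp: D_def loewner_le_def pos_semidef_def hermitian_def)
  have hY: "(matrix_inv Y)\<^sup>H = matrix_inv Y"
    using pos_def_matrix_inv[OF Y] by (simp add: pos_def_iff hermitian_def)
  have "matrix_inv X - matrix_inv Y =
      matrix_inv Y ** D ** matrix_inv Y + (D ** matrix_inv Y)\<^sup>H ** matrix_inv X ** (D ** matrix_inv Y)"
    unfolding conj_transpose_mult hD hY
    by (simp add: D_def matrix_distribs matrix_mul_assoc[symmetric] matrix_inv_cancel iX iY)
  moreover have "pos_semidef (matrix_inv Y ** D ** matrix_inv Y)"
    using pos_semidef_congruence[OF D, of "matrix_inv Y"] by (simp add: hY)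
  moreover have "pos_semidef ((D ** matrix_inv Y)\<^sup>H ** matrix_inv X ** (D ** matrix_inv Y))"
    by (intro pos_semidef_congruence pos_def_imp_pos_semidef pos_def_matrix_inv X)
  ultimately show ?thesis
    by (simp add: loewner_le_def pos_semidef_iff hermitian_intros rform_add)
qed

section \<open>Domination by a positive definite form\<close>

lemma rform_mat_1: "rform (mat 1) x = (\<Sum>i\<in>UNIV. (norm (x $ i))\<^sup>2)"
  by (simp add: rform_def quad_form_cinner cinner_def mult.commute[of "field_conj _"]
      mult_field_conj real_part_sum del: of_real_power)

lemma rform_bounded_mat_1:
  fixes M :: "'a::real_or_complex^'n^'n"
  obtains K where "K > 0" "\<And>x. \<bar>rform M x\<bar> \<le> K * rform (mat 1) x"
proof
  define K where "K = (\<Sum>i\<in>UNIV. \<Sum>j\<in>UNIV. norm (M $ i $ j)) + 1"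
  show "K > 0" unfolding K_def by (intro add_nonneg_pos sum_nonneg) auto
  fix x :: "'a^'n"
  \<comment> \<open>Each coordinate of a vector is at most its Euclidean norm, the square root of this form.\<close>
  have coord: "norm (x $ i) * norm (x $ j) \<le> rform (mat 1) x" for i j
  proof -
    have "(norm (x $ i))\<^sup>2 \<le> rform (mat 1) x" for i
      unfolding rform_mat_1 by (rule member_le_sum) auto
    then have "norm (x $ i) \<le> sqrt (rform (mat 1) x)" for i
      by (meson real_le_rsqrt)
    then have "norm (x $ i) * norm (x $ j) \<le> sqrt (rform (mat 1) x) * sqrt (rform (mat 1) x)"
      by (intro mult_mono) (auto simp: rform_mat_1 sum_nonneg)
    then show ?thesis by (simp add: rform_mat_1 sum_nonneg)
  qed
  have "\<bar>rform M x\<bar> \<le> norm (quad_form M x)"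
    unfolding rform_def by (rule abs_real_part_le_norm)
  also have "quad_form M x = (\<Sum>i\<in>UNIV. \<Sum>j\<in>UNIV. field_conj (x $ i) * (M $ i $ j * x $ j))"
    by (simp add: quad_form_cinner cinner_def matrix_vector_mult_def sum_distrib_left)
  also have "norm \<dots> \<le> (\<Sum>i\<in>UNIV. \<Sum>j\<in>UNIV. norm (M $ i $ j) * rform (mat 1) x)"
  proof (intro sum_norm_le)
    fix i j
    show "norm (field_conj (x $ i) * (M $ i $ j * x $ j)) \<le> norm (M $ i $ j) * rform (mat 1) x"
      using mult_left_mono[OF coord[of i j] norm_ge_zero[of "M $ i $ j"]]
      by (simp add: norm_mult mult_ac)
  qed
  also have "\<dots> \<le> K * rform (mat 1) x"
    by (simp add: K_def sum_distrib_right distrib_right) (simp add: rform_mat_1 sum_nonneg)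
  finally show "\<bar>rform M x\<bar> \<le> K * rform (mat 1) x" .
qed

lemma pos_def_mat_1: "pos_def (mat 1 :: 'a::real_or_complex^'n^'n)"
proof -
  have "rform (mat 1) x > 0" if x: "x \<noteq> 0" for x :: "'a^'n"
  proof -
    obtain i where "x $ i \<noteq> 0" using x by (auto simp: vec_eq_iff)
    then show ?thesis unfolding rform_mat_1 by (intro sum_pos2[of _ i]) auto
  qed
  then show ?thesis by (simp add: pos_def_iff hermitian_intros)
qed

text \<open>
The inverse of \<open>P\<close> is bounded above by a multiple of the identity, and inversion reverses the order.
\<close>

lemma pos_def_ge_mat_1:
  fixes P :: "'a::real_or_complex^'n^'n"
  assumes P: "pos_def P"
  obtains K where "K > 0" "\<And>x. rform (mat 1) x \<le> K * rform P x"
proof -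
  obtain K where K: "K > 0" "\<And>x. \<bar>rform (matrix_inv P) x\<bar> \<le> K * rform (mat 1) x"
    using rform_bounded_mat_1[of "matrix_inv P"] by blast
  have "matrix_inv P \<le>\<^sub>L K *\<^sub>R mat 1"
    using K(2) pos_def_matrix_inv[OF P]
    by (subst loewner_le_iff)
       (auto simp: hermitian_intros pos_def_iff rform_scaleR intro: order_trans[OF abs_ge_self])
  from loewner_le_matrix_inv[OF pos_def_matrix_inv[OF P] this]
  have "inverse K *\<^sub>R mat 1 \<le>\<^sub>L P"
    using K(1) pos_def_imp_invertible[OF pos_def_mat_1, where 'a='a and 'n='n]
      matrix_inv_unique[of "mat 1 :: 'a^'n^'n" "mat 1"]
    by (simp add: matrix_inv_inv pos_def_imp_invertible[OF P] matrix_inv_scaleR)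
  from loewner_leD[OF this] have "inverse K * rform (mat 1) x \<le> rform P x" for x
    by (simp add: rform_scaleR)
  then have "rform (mat 1) x \<le> K * rform P x" for x
    using K(1) by (simp add: field_simps)
  with K(1) show ?thesis by (rule that)
qed

lemma rform_bounded_pos_def:
  fixes M P :: "'a::real_or_complex^'n^'n"
  assumes P: "pos_def P"
  obtains K where "K > 0" "\<And>x. \<bar>rform M x\<bar> \<le> K * rform P x"
proof -
  obtain K where K: "K > 0" "\<And>x. rform (mat 1) x \<le> K * rform P x"
    using pos_def_ge_mat_1[OF P] by blast
  obtain L where L: "L > 0" "\<And>x. \<bar>rform M x\<bar> \<le> L * rform (mat 1) x"
    using rform_bounded_mat_1[of M] by blast
  have "\<bar>rform M x\<bar> \<le> (L * K) * rform P x" for x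
    using order_trans[OF L(2) mult_left_mono[OF K(2)]] L(1) by (simp add: mult.assoc)
  with K(1) L(1) show ?thesis by (intro that[of "L * K"]) auto
qed

lemma pseudo_inverse_exists:
  fixes M :: "'a::real_or_complex^'n^'n"
  obtains G :: "'a^'n^'n" where "M ** G ** M = M"
proof -
  obtain g where g: "Vector_Spaces.linear (*s) (*s) g" "\<forall>v\<in>range ((*v) M). M *v g v = v"
    using vec.linear_exists_right_inverse_on[OF matrix_vector_mul_linear_gen[of M] vec.subspace_UNIV]
    by blast
  have "(M ** matrix g ** M) *v x = M *v x" for x
    using g by (simp add: matrix_vector_mul_assoc[symmetric] matrix_works)
  then show ?thesis by (intro that[of "matrix g"]) (simp add: matrix_eq)
qed

text \<open>
The form of \<open>D\<close> at \<open>x\<close> is controlled by the vector \<open>D x\<close> alone: with a pseudo-inverse \<open>G\<close> it equals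
\<open>(D x)\<^sup>H G (D x)\<close>, even when \<open>D\<close> is singular.
\<close>

lemma rform_hermitian_bound_square:
  fixes D P :: "'a::real_or_complex^'n^'n"
  assumes D: "hermitian D" and P: "pos_def P"
  obtains K where "K > 0" "\<And>x. \<bar>rform D x\<bar> \<le> K * rform (D ** P ** D) x"
proof -
  have DH: "D\<^sup>H = D" using D by (simp add: hermitian_def)
  obtain G where G: "D ** G ** D = D" by (rule pseudo_inverse_exists)
  obtain K where K: "K > 0" "\<And>x. \<bar>rform G x\<bar> \<le> K * rform P x"
    using rform_bounded_pos_def[OF P, of G] by blast
  have "\<bar>rform D x\<bar> \<le> K * rform (D ** P ** D) x" for x
    using K(2)[of "D *v x"] rform_congruence[of D G x] rform_congruence[of D P x]
    by (simp add: DH G)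
  with K(1) show ?thesis by (rule that)
qed

section \<open>Hermitian matrices are determined by their quadratic forms\<close>

lemma bounded_linear_real_part: "bounded_linear (real_part :: 'a::real_or_complex \<Rightarrow> real)"
  by (rule bounded_linear_intro[of _ 1])
     (simp_all add: real_part_add real_part_scaleR abs_real_part_le_norm)

lemma bounded_linear_field_conj: "bounded_linear (field_conj :: 'a::real_or_complex \<Rightarrow> 'a)"
  by (rule bounded_linear_intro[of _ 1]) (simp_all add: field_conj_add field_conj_scaleR)

text \<open>
Over the reals \<open>u = 0\<close>, over the complex numbers \<open>u\<close> is the imaginary unit. Through this formula the
polarization below treats both fields at once.
\<close>

lemma scalar_from_real_parts:
  obtains u :: "'a::real_or_complex"
  where "\<And>z. z = of_real (real_part z) - u * of_real (real_part (u * z))"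
proof -
  consider (re) "\<forall>z::'a. z \<in> \<real> \<and> field_conj z = z"
    | (co) u :: 'a where "u * u = -1" "field_conj u = - u" "\<forall>z. \<exists>a b. z = of_real a + of_real b * u"
    using field_conj_cases[where 'a='a] by blast
  then show ?thesis
  proof cases
    case re
    have "z = of_real (real_part z) - 0 * of_real (real_part (0 * z))" for z :: 'a
      using re by (simp add: of_real_real_part)
    then show ?thesis by (rule that)
  next
    case co
    have "z = of_real (real_part z) - u * of_real (real_part (u * z))" for z :: 'a
    proof -
      have "of_real (real_part z) - u * of_real (real_part (u * z)) =
          (z + field_conj z) / 2 - ((u * u) * z - (u * u) * field_conj z) / 2"
        by (simp add: of_real_real_part field_conj_mult co(2) algebra_simps)
      also have "\<dots> = z" by (simp add: co(1) field_simps)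
      finally show ?thesis by simp
    qed
    then show ?thesis by (rule that)
  qed
qed

lemma rform_sum:
  "rform M x = (\<Sum>i\<in>UNIV. \<Sum>j\<in>UNIV. real_part (field_conj (x $ i) * (M $ i $ j * x $ j)))"
  by (simp add: rform_def quad_form_cinner cinner_def matrix_vector_mult_def sum_distrib_left
      real_part_sum)

text \<open>
Polarization. Together with \<open>scalar_from_real_parts\<close> it recovers every entry of a
Hermitian matrix from values of its quadratic form.
\<close>

lemma real_part_entry:
  fixes M :: "'a::real_or_complex^'n^'n"
  assumes "hermitian M"
  shows "real_part (c * M $ i $ j) =
    (rform M (axis i 1 + c *s axis j 1) - rform M (axis i 1) - rform M (c *s axis j 1)) / 2"
proof -
  define x y :: "'a^'n" where "x = axis i 1" and "y = c *s axis j 1"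
  have e: "cinner x (M *v y) = c * M $ i $ j"
  proof -
    have "cinner x z = z $ i" for z
      unfolding cinner_def x_def axis_def by (simp add: if_distrib[of "\<lambda>t. t * _"] if_distrib[of field_conj] cong: if_cong)
    then show ?thesis
      by (simp add: y_def matrix_vector_mult_def axis_def if_distrib cong: if_cong)
  qed
  have "rform M (x + y) = rform M x + rform M y + real_part (cinner x (M *v y))
      + real_part (cinner y (M *v x))"
    by (simp add: rform_def quad_form_cinner matrix_vector_right_distrib cinner_add_left
        cinner_add_right real_part_add)
  also have "cinner y (M *v x) = field_conj (cinner x (M *v y))"
    using assms unfolding hermitian_def by (subst field_conj_cinner) (subst cinner_adjoint, simp)
  also have "real_part (field_conj z) = real_part z" for z :: 'a
  proof -
    have "(of_real (real_part (field_conj z)) :: 'a) = of_real (real_part z)"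
      by (simp add: of_real_real_part field_conj_conj add.commute)
    then show ?thesis by (simp only: of_real_eq_iff)
  qed
  finally have "real_part (c * M $ i $ j) = (rform M (x + y) - rform M x - rform M y) / 2"
    by (simp add: e)
  then show ?thesis by (simp only: x_def y_def)
qed

lemma hermitian_eqI:
  fixes M N :: "'a::real_or_complex^'n^'n"
  assumes "hermitian M" "hermitian N" "\<And>x. rform M x = rform N x"
  shows "M = N"
proof -
  obtain u :: 'a where u: "\<And>z::'a. z = of_real (real_part z) - u * of_real (real_part (u * z))"
    using scalar_from_real_parts[where 'a='a] by blast
  have re: "real_part (c * M $ i $ j) = real_part (c * N $ i $ j)" for c i j
    by (simp add: real_part_entry assms)
  have "M $ i $ j = N $ i $ j" for i j
    using u[of "M $ i $ j"] u[of "N $ i $ j"] re[of 1 i j] re[of u i j] by simp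
  then show ?thesis by (simp add: vec_eq_iff)
qed

text \<open>
Polarization expresses the entries through the forms, so pointwise convergence of the forms suffices, and the limits of the
entries are built from limits of real sequences.
\<close>

lemma hermitian_sequence_tendsto:
  fixes X :: "nat \<Rightarrow> 'a::real_or_complex^'n^'n"
  assumes herm: "\<And>k. hermitian (X k)" and conv: "\<And>x. convergent (\<lambda>k. rform (X k) x)"
  obtains L where "X \<longlonglongrightarrow> L" "hermitian L" "\<And>x. (\<lambda>k. rform (X k) x) \<longlonglongrightarrow> rform L x"
proof -
  obtain u :: 'a where u: "\<And>z::'a. z = of_real (real_part z) - u * of_real (real_part (u * z))"
    using scalar_from_real_parts[where 'a='a] by blast
  have re: "convergent (\<lambda>k. real_part (c * X k $ i $ j))" for c i j
    unfolding real_part_entry[OF herm] divide_inverse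
    by (intro convergent_diff convergent_mult conv convergent_const)
  have "convergent (\<lambda>k. X k $ i $ j)" for i j
  proof -
    obtain a b where ab: "(\<lambda>k. real_part (X k $ i $ j)) \<longlonglongrightarrow> a"
        "(\<lambda>k. real_part (u * X k $ i $ j)) \<longlonglongrightarrow> b"
      using re[of 1 i j] re[of u i j] unfolding convergent_def by auto
    have "(\<lambda>k. of_real (real_part (X k $ i $ j)) - u * of_real (real_part (u * X k $ i $ j)))
        \<longlonglongrightarrow> of_real a - u * of_real b"
      by (intro tendsto_intros ab)
    then show ?thesis unfolding u[symmetric] convergent_def by blast
  qed
  then obtain l where l: "\<And>i j. (\<lambda>k. X k $ i $ j) \<longlonglongrightarrow> l i j"
    unfolding convergent_def by metis
  define L :: "'a^'n^'n" where "L = (\<chi> i j. l i j)"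
  have entry: "(\<lambda>k. X k $ i $ j) \<longlonglongrightarrow> L $ i $ j" for i j
    using l by (simp add: L_def)
  then have "X \<longlonglongrightarrow> L" by (intro vec_tendstoI)
  moreover have "hermitian L"
  proof -
    have "field_conj (L $ j $ i) = L $ i $ j" for i j
    proof (rule LIMSEQ_unique)
      show "(\<lambda>k. field_conj (X k $ j $ i)) \<longlonglongrightarrow> field_conj (L $ j $ i)"
        by (rule bounded_linear.tendsto[OF bounded_linear_field_conj entry])
      have "field_conj (X k $ j $ i) = X k $ i $ j" for k
        using herm[of k] unfolding hermitian_def by (metis conj_transpose_nth)
      then show "(\<lambda>k. field_conj (X k $ j $ i)) \<longlonglongrightarrow> L $ i $ j" using entry by simp
    qed
    then show ?thesis by (simp add: hermitian_def vec_eq_iff)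
  qed
  moreover have "(\<lambda>k. rform (X k) x) \<longlonglongrightarrow> rform L x" for x
    unfolding rform_sum
    by (intro tendsto_intros bounded_linear.tendsto[OF bounded_linear_real_part] entry)
  ultimately show ?thesis by (rule that)
qed

section \<open>Positive involutive automorphisms of the matrix ring\<close>

text \<open>
The deviation \<open>d\<close> from linearity is additive and vanishes at the integers, so it has period 1; on the
unit interval monotonicity of \<open>g\<close> bounds it. A bounded additive function is zero, because
\<open>d (n t) = n d t\<close>.
\<close>

lemma additive_nonneg_linear:
  fixes g :: "real \<Rightarrow> real"
  assumes add: "\<And>s t. g (s + t) = g s + g t" and nonneg: "\<And>t. t \<ge> 0 \<Longrightarrow> g t \<ge> 0"
  shows "g t = t * g 1"
proof -
  define d where "d t = g t - t * g 1" for t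
  have d_add: "d (s + t) = d s + d t" for s t by (simp add: d_def add algebra_simps)
  have d0: "d 0 = 0" using d_add[of 0 0] by simp
  have d_minus: "d (- t) = - d t" for t using d_add[of t "- t"] d0 by simp
  have d1: "d 1 = 0" by (simp add: d_def)
  have d_nat: "d (real n * t) = real n * d t" for n t
    by (induction n) (simp_all add: d0 d_add distrib_right)
  have d_int: "d (of_int k) = 0" for k
    using d_nat[of _ 1] d_minus by (cases k) (simp_all add: d1 del: of_nat_Suc)
  have bound: "\<bar>d t\<bar> \<le> g 1" for t
  proof -
    have "d t = d (of_int \<lfloor>t\<rfloor> + frac t)" by (simp add: frac_def)
    then have "d t = d (frac t)" by (simp only: d_add d_int)
    moreover have "0 \<le> g (frac t)" "0 \<le> g (1 - frac t)" "0 \<le> g 1"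
      using frac_lt_1[of t] by (auto intro!: nonneg)
    moreover have "g 1 = g (frac t) + g (1 - frac t)" using add[of "frac t" "1 - frac t"] by simp
    moreover have "0 \<le> frac t * g 1" "frac t * g 1 \<le> g 1"
      using frac_lt_1[of t] \<open>0 \<le> g 1\<close> by (auto intro: mult_left_le_one_le)
    moreover have "d (frac t) = g (frac t) - frac t * g 1" by (simp only: d_def)
    ultimately show ?thesis by linarith
  qed
  have "d t = 0"
  proof (rule ccontr)
    assume "d t \<noteq> 0"
    then obtain n where n: "g 1 < real n * \<bar>d t\<bar>"
      using reals_Archimedean3[of "\<bar>d t\<bar>"] by auto
    have "real n * \<bar>d t\<bar> = \<bar>d (real n * t)\<bar>" by (simp add: d_nat abs_mult)
    also have "\<dots> \<le> g 1" by (rule bound)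
    finally show False using n by simp
  qed
  then show ?thesis by (simp add: d_def)
qed

text \<open>
It suffices to commute with the matrices \<open>N\<close> whose only nonzero column is an arbitrary vector \<open>u\<close>:
comparing that column shows that every \<open>u\<close> is an eigenvector with the same eigenvalue.
\<close>

lemma central_matrix_scalar:
  fixes K :: "'a::real_or_complex^'n^'n"
  assumes "\<And>N. K ** N = N ** K"
  obtains c where "K = mat c"
proof -
  fix j :: 'n
  have "K *v u = K $ j $ j *s u" for u
  proof -
    define N :: "'a^'n^'n" where "N = (\<chi> r c. if c = j then u $ r else 0)"
    have "(K *v u) $ r = K $ j $ j * u $ r" for r
    proof -
      have "(K ** N) $ r $ j = (K *v u) $ r"
        by (simp add: N_def matrix_matrix_mult_def matrix_vector_mult_def)
      moreover have "(N ** K) $ r $ j = u $ r * K $ j $ j"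
        by (simp add: N_def matrix_matrix_mult_def if_distrib[of "\<lambda>t. t * _"] cong: if_cong)
      ultimately show ?thesis using assms[of N] by (simp add: mult.commute)
    qed
    then show ?thesis by (simp add: vec_eq_iff)
  qed
  moreover have "mat c *v u = c *s u" for c and u :: "'a^'n"
    by (simp add: vec_eq_iff matrix_vector_mult_def mat_def if_distrib[of "\<lambda>t. t * _"] cong: if_cong)
  ultimately have "K = mat (K $ j $ j)" by (simp add: matrix_eq)
  then show ?thesis by (rule that)
qed

lemma mat_mult_left: "mat c ** N = (\<chi> i j. c * (N::'a::real_or_complex^'n^'n) $ i $ j)"
  by (simp add: vec_eq_iff matrix_matrix_mult_def mat_def if_distrib[of "\<lambda>t. t * _"] cong: if_cong)

lemma mat_mult_right: "N ** mat c = (\<chi> i j. (N::'a::real_or_complex^'n^'n) $ i $ j * c)"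
  by (simp add: vec_eq_iff matrix_matrix_mult_def mat_def if_distrib[of "\<lambda>t. _ * t"] cong: if_cong)

locale psd_involution =
  fixes f :: "'a::real_or_complex^'n^'n \<Rightarrow> 'a^'n^'n"
  assumes f_f: "f (f M) = M"
    and f_add: "f (M + N) = f M + f N"
    and f_mult: "f (M ** N) = f M ** f N"
    and f_pos_semidef: "pos_semidef M \<Longrightarrow> pos_semidef (f M)"
    and f_pos_def: "pos_def M \<Longrightarrow> pos_def (f M)"
begin

lemma f_zero [simp]: "f 0 = 0"
  using f_add[of 0 0] by simp

lemma f_minus: "f (- M) = - f M"
  using f_add[of M "- M"] by (simp add: eq_neg_iff_add_eq_0 add.commute)

lemma f_diff: "f (M - N) = f M - f N"
  using f_add[of M "- N"] by (simp add: f_minus)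

lemma f_mat_1 [simp]: "f (mat 1) = mat 1"
proof -
  have "mat 1 = f (mat 1 ** f (mat 1))" by (simp add: f_f)
  also have "\<dots> = f (mat 1) ** f (f (mat 1))" by (rule f_mult)
  finally show ?thesis by (simp add: f_f)
qed

lemma f_inverse: "M ** N = mat 1 \<Longrightarrow> f M ** f N = mat 1"
  by (simp add: f_mult[symmetric])

lemma f_invertible: "invertible M \<Longrightarrow> invertible (f M)"
  using f_inverse[OF matrix_inv_cancel(1)] invertibleI by blast

lemma f_matrix_inv: "invertible M \<Longrightarrow> f (matrix_inv M) = matrix_inv (f M)"
  using f_inverse[OF matrix_inv_cancel(1)] matrix_inv_unique by metis

text \<open>
A Hermitian matrix plus a large multiple of the identity is positive semidefinite, so every Hermitian
matrix is a difference of two positive semidefinite ones.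
\<close>

lemma f_hermitian:
  assumes "hermitian M" shows "hermitian (f M)"
proof -
  obtain K where K: "K > 0" "\<And>x. \<bar>rform M x\<bar> \<le> K * rform (mat 1) x"
    using rform_bounded_mat_1[of M] by blast
  have "0 \<le> K * rform (mat 1) x + rform M x" for x
    using K(2)[of x] by (simp add: abs_le_iff)
  then have "pos_semidef (K *\<^sub>R mat 1 + M)"
    using assms by (simp add: pos_semidef_iff hermitian_intros rform_simps)
  moreover have "pos_semidef (K *\<^sub>R mat 1 :: 'a^'n^'n)"
    by (intro pos_def_imp_pos_semidef pos_def_scaleR pos_def_mat_1 K)
  ultimately have "hermitian (f (K *\<^sub>R mat 1 + M) - f (K *\<^sub>R mat 1))"
    using f_pos_semidef pos_semidef_iff hermitian_intros(2) by blast
  then show ?thesis by (simp add: f_add)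
qed

lemma f_mono: "X \<le>\<^sub>L Y \<Longrightarrow> f X \<le>\<^sub>L f Y"
  using f_pos_semidef by (auto simp: loewner_le_def f_diff[symmetric])

text \<open>
Additivity gives homogeneity only for rational factors; positivity extends it to real ones.
\<close>

lemma f_scaleR_pos_semidef:
  assumes "pos_semidef M" shows "f (r *\<^sub>R M) = r *\<^sub>R f M"
proof (rule hermitian_eqI)
  have h: "hermitian M" using assms by (simp add: pos_semidef_iff)
  then show "hermitian (f (r *\<^sub>R M))" "hermitian (r *\<^sub>R f M)"
    by (simp_all add: hermitian_intros f_hermitian)
  fix x
  have "rform (f (r *\<^sub>R M)) x = r * rform (f (1 *\<^sub>R M)) x"
  proof (rule additive_nonneg_linear)
    show "rform (f ((s + t) *\<^sub>R M)) x = rform (f (s *\<^sub>R M)) x + rform (f (t *\<^sub>R M)) x" for s t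
      by (simp add: scaleR_add_left f_add rform_add)
    show "0 \<le> rform (f (t *\<^sub>R M)) x" if "0 \<le> t" for t
      using f_pos_semidef[of "t *\<^sub>R M"] assms that
      by (simp add: pos_semidef_iff hermitian_intros rform_scaleR)
  qed
  then show "rform (f (r *\<^sub>R M)) x = rform (r *\<^sub>R f M) x"
    by (simp add: rform_scaleR)
qed

text \<open>
The matrices \<open>M\<close> with this property are closed under sums and products and contain the Hermitian
ones, so it is enough that Hermitian matrices generate the ring. Over the reals they do: the \<open>i\<close>-th
row of \<open>M\<close> is a diagonal unit \<open>E i\<close> times a symmetric matrix, up to a diagonal correction. Over the
complex numbers \<open>M\<close> is \<open>S + i T\<close> with Hermitian \<open>S\<close> and \<open>T\<close>, and only the scalar matrix of the
imaginary unit remains (for size 1 it is no product of Hermitian matrices). Its image is central with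
square \<open>-1\<close>, hence the scalar matrix of the imaginary unit or its negative.
\<close>

lemma f_conj_transpose: "f (M\<^sup>H) = (f M)\<^sup>H"
proof -
  define G where "G = {M. f (M\<^sup>H) = (f M)\<^sup>H}"
  have G_herm: "M \<in> G" if "hermitian M" for M
    using that f_hermitian[OF that] by (simp add: G_def hermitian_def)
  have G_add: "M + N \<in> G" if "M \<in> G" "N \<in> G" for M N
    using that by (simp add: G_def conj_transpose_add f_add)
  have G_mult: "M ** N \<in> G" if "M \<in> G" "N \<in> G" for M N
    using that by (simp add: G_def conj_transpose_mult f_mult)
  have G_sum: "sum g S \<in> G" if "\<And>i. g i \<in> G" for g :: "'n \<Rightarrow> _" and S
    by (induction S rule: infinite_finite_induct) (auto simp: that G_add G_herm hermitian_def)
  consider (re) "\<forall>z::'a. z \<in> \<real> \<and> field_conj z = z"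
    | (co) u :: 'a where "u * u = -1" "field_conj u = - u"
    using field_conj_cases[where 'a='a] by blast
  then have "M \<in> G"
  proof cases
    case re
    define E :: "'n \<Rightarrow> 'a^'n^'n" where "E i = (\<chi> r c. if r = i \<and> c = i then 1 else 0)" for i
    have E_mult: "E i ** N = (\<chi> r c. if r = i then N $ r $ c else 0)" for i N
      by (auto simp: vec_eq_iff E_def matrix_matrix_mult_def if_distrib[of "\<lambda>t. t * _"] cong: if_cong)
    have mult_E: "N ** E i = (\<chi> r c. if c = i then N $ r $ c else 0)" for i N
      by (auto simp: vec_eq_iff E_def matrix_matrix_mult_def if_distrib[of "\<lambda>t. _ * t"] cong: if_cong)
    have E_herm: "hermitian (E i)" for i
      by (auto simp: hermitian_def E_def vec_eq_iff)
    have E_E: "E i ** E i = E i" for i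
      by (auto simp: E_mult) (auto simp: E_def vec_eq_iff)
    have "E i ** M \<in> G" for i
    proof -
      have "hermitian (E i ** M + M\<^sup>H ** E i)"
        using E_herm[of i] by (simp add: hermitian_def conj_transpose_simps add.commute)
      moreover have "hermitian (- (E i ** M\<^sup>H ** E i))"
        using re by (auto simp: hermitian_def E_mult mult_E vec_eq_iff)
      moreover have "E i ** M = E i ** (E i ** M + M\<^sup>H ** E i) + - (E i ** M\<^sup>H ** E i)"
        by (simp add: matrix_distribs matrix_mul_assoc E_E)
      ultimately show ?thesis by (metis G_add G_mult G_herm E_herm)
    qed
    then have "(\<Sum>i\<in>UNIV. E i ** M) \<in> G" by (rule G_sum)
    moreover have "(\<Sum>i\<in>UNIV. E i ** M) = M"
      by (simp add: vec_eq_iff E_mult)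
    ultimately show ?thesis by simp
  next
    case co
    define J :: "'a^'n^'n" where "J = mat u"
    have central: "J ** N = N ** J" for N
      by (simp add: J_def mat_mult_left mat_mult_right mult.commute)
    have JJ: "J ** J = - mat 1"
      by (simp add: J_def mat_mult_left) (simp add: vec_eq_iff mat_def co(1))
    have J_adj: "J\<^sup>H = - J" by (auto simp: J_def vec_eq_iff mat_def co(2))
    have "f J ** N = N ** f J" for N
      using arg_cong[OF central[of "f N"], of f] by (simp add: f_mult f_f)
    then obtain c where c: "f J = mat c" by (rule central_matrix_scalar)
    have "mat c ** mat c = (- mat 1 :: 'a^'n^'n)"
      using arg_cong[OF JJ, of f] by (simp add: f_mult f_minus c)
    then have "(mat c ** mat c :: 'a^'n^'n) $ i $ i = (- mat 1 :: 'a^'n^'n) $ i $ i" for i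
      by simp
    then have "c * c = - 1" by (simp add: mat_mult_left) (simp add: mat_def)
    then have "c * c = u * u" using co(1) by simp
    then have "c = u \<or> c = - u" by (simp add: square_eq_iff)
    then have "field_conj c = - c" using co(2) by (auto simp: field_conj_minus)
    then have "(f J)\<^sup>H = - f J" unfolding c by (auto simp: vec_eq_iff mat_def)
    then have "J \<in> G" by (simp add: G_def J_adj f_minus)
    moreover define Y where "Y = (- 1 / 2) *\<^sub>R (J ** (M - M\<^sup>H))"
    have "hermitian Y"
      by (simp add: Y_def hermitian_def conj_transpose_simps J_adj central matrix_distribs)
    moreover have "hermitian ((1 / 2) *\<^sub>R (M + M\<^sup>H))"
      by (simp add: hermitian_def conj_transpose_simps add.commute)
    ultimately have "(1 / 2) *\<^sub>R (M + M\<^sup>H) + J ** Y \<in> G" by (metis G_add G_mult G_herm)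
    moreover have "J ** Y = (1 / 2) *\<^sub>R (M - M\<^sup>H)"
      by (simp add: Y_def matrix_scaleR_right matrix_minus_right matrix_mul_assoc JJ
          matrix_minus_left scaleR_right_diff_distrib)
    moreover have "(1 / 2) *\<^sub>R (M + M\<^sup>H) + (1 / 2) *\<^sub>R (M - M\<^sup>H) = (1 / 2) *\<^sub>R (M + M)"
      by (simp add: algebra_simps)
    ultimately show ?thesis by simp
  qed
  then show ?thesis by (simp add: G_def)
qed

end

section \<open>The fixed-point iteration\<close>

locale matrix_equation = psd_involution f
  for f :: "'a::real_or_complex^'n^'n \<Rightarrow> 'a^'n^'n" +
  fixes A Q :: "'a^'n^'n"
  assumes A: "invertible A" and Q: "pos_def Q"
begin

definition \<phi> :: "'a^'n^'n \<Rightarrow> 'a^'n^'n"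
  where "\<phi> X = Q + A\<^sup>H ** matrix_inv (f X) ** A"

lemma is_solution_iff: "is_solution f A Q X \<longleftrightarrow> invertible (f X) \<and> \<phi> X = X"
  by (auto simp: is_solution_def \<phi>_def algebra_simps)

lemma increment_pos_def: "pos_def X \<Longrightarrow> pos_def (A\<^sup>H ** matrix_inv (f X) ** A)"
  by (intro pos_def_congruence pos_def_matrix_inv f_pos_def A)

lemma Q_le_\<phi>: "pos_def X \<Longrightarrow> Q \<le>\<^sub>L \<phi> X"
  using pos_def_imp_pos_semidef[OF increment_pos_def] by (simp add: loewner_le_def \<phi>_def)

lemma pos_def_\<phi>: "pos_def X \<Longrightarrow> pos_def (\<phi> X)"
  using pos_def_mono[OF Q Q_le_\<phi>] .

lemma \<phi>_antimono:
  assumes "pos_def X" "X \<le>\<^sub>L Y" shows "\<phi> Y \<le>\<^sub>L \<phi> X"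
  unfolding \<phi>_def
  by (intro loewner_le_add_left loewner_le_congruence loewner_le_matrix_inv f_pos_def f_mono assms)

text \<open>
Writing \<open>t = 1 - s\<close>, the hypothesis \<open>t X \<le> Y\<close> bounds the increment of \<open>\<phi> Y\<close> over \<open>Q\<close> by \<open>1/t\<close>
times that of \<open>\<phi> X\<close>. The summand \<open>Q\<close> itself is not stretched, and it carries at least the fraction
\<open>a\<close> of \<open>\<phi> Y\<close>; this is why the relative gap \<open>s\<close> shrinks by the factor \<open>1 - a\<close>.
\<close>

lemma \<phi>_contraction:
  assumes X: "pos_def X" and Y: "pos_def Y" and s: "0 \<le> s" "s < 1"
    and le: "(1 - s) *\<^sub>R X \<le>\<^sub>L Y" and a: "a *\<^sub>R \<phi> Y \<le>\<^sub>L Q"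
  shows "(1 - s * (1 - a)) *\<^sub>R \<phi> Y \<le>\<^sub>L \<phi> X"
proof -
  define t where "t = 1 - s"
  have t: "t > 0" using s by (simp add: t_def)
  have "t *\<^sub>R f X \<le>\<^sub>L f Y"
    using f_mono[OF le] f_scaleR_pos_semidef[OF pos_def_imp_pos_semidef[OF X]] by (simp add: t_def)
  then have "matrix_inv (f Y) \<le>\<^sub>L matrix_inv (t *\<^sub>R f X)"
    by (intro loewner_le_matrix_inv pos_def_scaleR f_pos_def X t)
  then have "A\<^sup>H ** matrix_inv (f Y) ** A \<le>\<^sub>L A\<^sup>H ** (inverse t *\<^sub>R matrix_inv (f X)) ** A"
    using t X by (intro loewner_le_congruence)
      (simp add: matrix_inv_scaleR pos_def_imp_invertible f_pos_def)
  from loewner_leD[OF this] have "rform (\<phi> Y - Q) x \<le> inverse t * rform (\<phi> X - Q) x" for x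
    by (simp add: \<phi>_def matrix_scaleR_left matrix_scaleR_right rform_scaleR)
  then have 1: "t * rform (\<phi> Y - Q) x \<le> rform (\<phi> X - Q) x" for x
    using t by (simp add: field_simps)
  have 2: "s * (a * rform (\<phi> Y) x) \<le> s * rform Q x" for x
    using loewner_leD[OF a] s by (intro mult_left_mono) (simp_all add: rform_scaleR)
  have "(1 - s * (1 - a)) * rform (\<phi> Y) x \<le> rform (\<phi> X) x" for x
    using 1[of x] 2[of x] by (simp add: t_def rform_diff algebra_simps)
  then show ?thesis
    by (subst loewner_le_iff)
       (simp_all add: hermitian_intros pos_def_imp_hermitian pos_def_\<phi> X Y rform_scaleR)
qed

definition even_iterate :: "nat \<Rightarrow> 'a^'n^'n"
  where "even_iterate k = ((\<lambda>X. \<phi> (\<phi> X)) ^^ k) Q"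

definition odd_iterate :: "nat \<Rightarrow> 'a^'n^'n"
  where "odd_iterate k = \<phi> (even_iterate k)"

lemma even_iterate_0 [simp]: "even_iterate 0 = Q"
  and even_iterate_Suc: "even_iterate (Suc k) = \<phi> (odd_iterate k)"
  by (simp_all add: even_iterate_def odd_iterate_def)

lemma pos_def_even_iterate: "pos_def (even_iterate k)"
  by (induction k) (simp_all add: Q pos_def_\<phi> even_iterate_Suc odd_iterate_def)

lemma pos_def_odd_iterate: "pos_def (odd_iterate k)"
  by (simp add: odd_iterate_def pos_def_\<phi> pos_def_even_iterate)

lemma even_iterate_mono: "even_iterate k \<le>\<^sub>L even_iterate (Suc k)"
proof (induction k)
  case 0
  show ?case by (simp add: even_iterate_Suc Q_le_\<phi> pos_def_odd_iterate)
next
  case (Suc k)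
  then show ?case unfolding even_iterate_Suc odd_iterate_def
    by (intro \<phi>_antimono pos_def_\<phi> pos_def_even_iterate pos_def_odd_iterate)
       (simp_all add: even_iterate_Suc odd_iterate_def)
qed

lemma odd_iterate_antimono: "odd_iterate (Suc k) \<le>\<^sub>L odd_iterate k"
  unfolding odd_iterate_def by (intro \<phi>_antimono pos_def_even_iterate even_iterate_mono)

lemma Q_le_even_iterate: "Q \<le>\<^sub>L even_iterate k"
  using even_iterate_mono loewner_le_trans by (induction k) auto

lemma odd_iterate_le: "odd_iterate k \<le>\<^sub>L \<phi> Q"
  unfolding odd_iterate_def by (intro \<phi>_antimono Q Q_le_even_iterate)

lemma even_iterate_le_odd_iterate: "even_iterate k \<le>\<^sub>L odd_iterate k"
proof (induction k)
  case 0
  show ?case by (simp add: odd_iterate_def Q_le_\<phi> Q)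
next
  case (Suc k)
  have "even_iterate (Suc k) \<le>\<^sub>L odd_iterate k"
    unfolding even_iterate_Suc odd_iterate_def[of k]
    by (rule \<phi>_antimono) (use Suc in \<open>simp_all add: pos_def_even_iterate odd_iterate_def\<close>)
  from \<phi>_antimono[OF pos_def_even_iterate this] show ?case
    by (simp add: even_iterate_Suc odd_iterate_def)
qed

text \<open>
The odd iterates decrease to a limit \<open>X\<close>. The relative gap between even and odd iterates shrinks
geometrically by the contraction estimate, so the even iterates increase to the same \<open>X\<close>. Since \<open>X\<close>
lies between \<open>even_iterate k\<close> and \<open>odd_iterate k\<close>, its image lies between \<open>even_iterate (Suc k)\<close> and
\<open>odd_iterate k\<close>, and the squeeze forces \<open>\<phi> X = X\<close>.
\<close>

lemma odd_iterate_converges: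
  obtains X where "odd_iterate \<longlonglongrightarrow> X" "pos_def X" "\<phi> X = X"
proof -
  obtain K where K: "K > 0" "\<And>x. \<bar>rform (\<phi> Q) x\<bar> \<le> K * rform Q x"
    using rform_bounded_pos_def[OF Q, of "\<phi> Q"] by blast
  \<comment> \<open>Adding 1 to \<open>K\<close> keeps \<open>a\<close> strictly below 1, as the power estimates require.\<close>
  define a where "a = inverse (K + 1)"
  have a: "0 < a" "a < 1" using K(1) by (auto simp: a_def field_simps)
  have a_bound: "a *\<^sub>R Y \<le>\<^sub>L Q" if "Y \<le>\<^sub>L \<phi> Q" "hermitian Y" for Y
  proof -
    have "a * rform Y x \<le> rform Q x" for x
    proof -
      have "rform Y x \<le> K * rform Q x"
        using loewner_leD[OF that(1), of x] K(2)[of x] by (simp add: abs_le_iff)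
      also have "\<dots> \<le> (K + 1) * rform Q x"
        using pos_def_imp_pos_semidef[OF Q] by (simp add: pos_semidef_iff distrib_right)
      finally show ?thesis using K(1) by (simp add: a_def field_simps)
    qed
    then show ?thesis using that(2) Q
      by (simp add: loewner_le_iff hermitian_intros pos_def_imp_hermitian rform_scaleR)
  qed
  \<comment> \<open>Each application of \<open>\<phi>\<close> swaps the two sides and contributes one factor \<open>1 - a\<close>; one step in
    \<open>k\<close> consists of two applications.\<close>
  have gap: "(1 - (1 - a) ^ (2 * k + 1)) *\<^sub>R odd_iterate k \<le>\<^sub>L even_iterate k" for k
  proof (induction k)
    case 0
    show ?case
      using a_bound[of "\<phi> Q"] by (simp add: odd_iterate_def pos_def_imp_hermitian pos_def_\<phi> Q)
  next
    case (Suc k)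
    have s: "0 \<le> (1 - a) ^ m" "(1 - a) ^ Suc m < 1" for m
      using a power_Suc_less_one[of "1 - a" m] by simp_all
    have odd: "a *\<^sub>R odd_iterate j \<le>\<^sub>L Q" for j
      by (rule a_bound[OF odd_iterate_le pos_def_imp_hermitian[OF pos_def_odd_iterate]])
    have "(1 - (1 - a) ^ (2 * k + 1) * (1 - a)) *\<^sub>R \<phi> (even_iterate k) \<le>\<^sub>L \<phi> (odd_iterate k)"
      using s[of "2 * k + 1"] s(2)[of "2 * k"] Suc odd[of k]
      by (intro \<phi>_contraction pos_def_odd_iterate pos_def_even_iterate)
         (simp_all add: odd_iterate_def)
    then have half: "(1 - (1 - a) ^ (2 * k + 2)) *\<^sub>R odd_iterate k \<le>\<^sub>L even_iterate (Suc k)"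
      by (simp add: even_iterate_Suc odd_iterate_def mult.commute)
    have "(1 - (1 - a) ^ (2 * k + 2) * (1 - a)) *\<^sub>R \<phi> (even_iterate (Suc k)) \<le>\<^sub>L \<phi> (odd_iterate k)"
      using s[of "2 * k + 2"] s(2)[of "2 * k + 1"] half odd[of "Suc k"]
      by (intro \<phi>_contraction pos_def_odd_iterate pos_def_even_iterate)
         (simp_all add: odd_iterate_def)
    then show ?case
      by (simp add: even_iterate_Suc[symmetric] odd_iterate_def[symmetric] mult_ac)
  qed
  have nonneg: "0 \<le> rform (odd_iterate k) x" for k x
    using pos_def_imp_pos_semidef[OF pos_def_odd_iterate] by (simp add: pos_semidef_iff)
  have dec: "decseq (\<lambda>k. rform (odd_iterate k) x)" for x
    by (intro decseq_SucI loewner_leD odd_iterate_antimono)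
  have inc: "incseq (\<lambda>k. rform (even_iterate k) x)" for x
    by (intro incseq_SucI loewner_leD even_iterate_mono)
  have conv: "convergent (\<lambda>k. rform (odd_iterate k) x)" for x
    using decseq_convergent[OF dec] nonneg unfolding convergent_def by metis
  obtain X where X: "odd_iterate \<longlonglongrightarrow> X" "hermitian X"
      "\<And>x. (\<lambda>k. rform (odd_iterate k) x) \<longlonglongrightarrow> rform X x"
    using hermitian_sequence_tendsto[OF pos_def_imp_hermitian[OF pos_def_odd_iterate] conv] by blast
  have even_lim: "(\<lambda>k. rform (even_iterate k) x) \<longlonglongrightarrow> rform X x" for x
  proof (rule tendsto_sandwich)
    have "(\<lambda>k. (1 - a) ^ (2 * k + 1)) \<longlonglongrightarrow> 0"
    proof -
      have "(\<lambda>n. (1 - a) ^ n) \<longlonglongrightarrow> 0" using a by (intro LIMSEQ_power_zero) simp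
      from LIMSEQ_subseq_LIMSEQ[OF this, of "\<lambda>k. 2 * k + 1"] show ?thesis
        by (simp add: strict_mono_def o_def)
    qed
    then have "(\<lambda>k. (1 - (1 - a) ^ (2 * k + 1)) * rform (odd_iterate k) x) \<longlonglongrightarrow> (1 - 0) * rform X x"
      by (intro tendsto_intros X)
    then show "(\<lambda>k. (1 - (1 - a) ^ (2 * k + 1)) * rform (odd_iterate k) x) \<longlonglongrightarrow> rform X x" by simp
    show "\<forall>\<^sub>F k in sequentially. (1 - (1 - a) ^ (2 * k + 1)) * rform (odd_iterate k) x
        \<le> rform (even_iterate k) x"
      using loewner_leD[OF gap] by (simp add: rform_scaleR)
    show "\<forall>\<^sub>F k in sequentially. rform (even_iterate k) x \<le> rform (odd_iterate k) x"
      using loewner_leD[OF even_iterate_le_odd_iterate] by simp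
  qed (rule X)
  have herm: "hermitian (even_iterate k)" "hermitian (odd_iterate k)" for k
    by (intro pos_def_imp_hermitian pos_def_even_iterate pos_def_odd_iterate)+
  have above: "even_iterate k \<le>\<^sub>L X" for k
    unfolding loewner_le_iff[OF herm(1) X(2)] using incseq_le[OF inc even_lim] by blast
  have below: "X \<le>\<^sub>L odd_iterate k" for k
    unfolding loewner_le_iff[OF X(2) herm(2)] using decseq_ge[OF dec X(3)] by blast
  have pd: "pos_def X" using pos_def_mono[OF Q] above[of 0] by simp
  have up: "\<phi> X \<le>\<^sub>L odd_iterate k" for k
    unfolding odd_iterate_def by (intro \<phi>_antimono pos_def_even_iterate above)
  have lo: "even_iterate (Suc k) \<le>\<^sub>L \<phi> X" for k
    unfolding even_iterate_Suc by (intro \<phi>_antimono pd below)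
  have "\<phi> X = X"
  proof (rule hermitian_eqI[OF pos_def_imp_hermitian[OF pos_def_\<phi>[OF pd]] X(2)])
    fix x
    show "rform (\<phi> X) x = rform X x"
    proof (rule antisym)
      show "rform (\<phi> X) x \<le> rform X x"
        by (rule LIMSEQ_le_const[OF X(3)]) (use loewner_leD[OF up] in blast)
      show "rform X x \<le> rform (\<phi> X) x"
        by (rule LIMSEQ_le_const2[OF LIMSEQ_Suc[OF even_lim]]) (use loewner_leD[OF lo] in blast)
    qed
  qed
  with X(1) pd show ?thesis by (rule that)
qed

section \<open>Maximality among all Hermitian solutions\<close>

text \<open>
The other solution \<open>X\<close> may be indefinite, so order arguments for \<open>\<phi>\<close> do not apply to it. With
\<open>D = P - X\<close>, \<open>W = P - Q\<close> and \<open>T = f(X)\<^sup>-\<^sup>1 A\<close>, the two fixed-point equations combine to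
\<open>D + T\<^sup>H f(D) T = D W\<^sup>-\<^sup>1 D = T\<^sup>H f(D) f(P)\<^sup>-\<^sup>1 f(D) T\<close>.
Apply \<open>f\<close> to this and compose: with \<open>U = f(T) T\<close> and \<open>E = D P\<^sup>-\<^sup>1 D\<close>, the bound \<open>c W \<le> P\<close> for
some \<open>c > 1\<close> yields \<open>D(x) \<le> D(U x)\<close> and \<open>c E(x) \<le> E(U x)\<close> for the quadratic forms. Backwards
along \<open>U\<close> the form \<open>E\<close> decays to zero while \<open>D\<close> does not increase, and \<open>\<bar>D\<bar> \<le> L E\<close> for some
constant \<open>L\<close>. Hence \<open>D(x)\<close> cannot be negative.
\<close>

lemma hermitian_solution_le:
  assumes P: "pos_def P" and P_sol: "\<phi> P = P"
    and X: "hermitian X" and X_sol: "is_solution f A Q X"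
  shows "X \<le>\<^sub>L P"
proof -
  define D where "D = P - X"
  define W where "W = A\<^sup>H ** matrix_inv (f P) ** A"
  define T where "T = matrix_inv (f X) ** A"
  define U where "U = f T ** T"
  define E where "E = D ** matrix_inv P ** D"
  have fP: "pos_def (f P)" and ifP: "invertible (f P)"
    using f_pos_def[OF P] pos_def_imp_invertible by auto
  have ifX: "invertible (f X)" using X_sol by (simp add: is_solution_def)
  have hP: "hermitian P" by (rule pos_def_imp_hermitian[OF P])
  have hD: "hermitian D" by (simp add: D_def hermitian_intros hP X)
  have DH: "D\<^sup>H = D" using hD by (simp add: hermitian_def)
  have fDH: "(f D)\<^sup>H = f D" using f_hermitian[OF hD] by (simp add: hermitian_def)
  have W: "pos_def W" unfolding W_def by (rule increment_pos_def[OF P])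
  have iW: "invertible W" by (rule pos_def_imp_invertible[OF W])
  have W_eq: "W = P - Q" using P_sol by (simp add: W_def \<phi>_def algebra_simps)
  have W_inv: "matrix_inv W = matrix_inv A ** f P ** (matrix_inv A)\<^sup>H"
    unfolding W_def
    by (rule matrix_inv_unique)
       (simp add: matrix_inv_conj_transpose[OF A, symmetric] matrix_mul_assoc[symmetric]
         matrix_inv_cancel A ifP invertible_conj_transpose)
  have iT: "invertible T" unfolding T_def
    by (intro invertible_mult invertible_matrix_inv ifX A)
  have iU: "invertible U" unfolding U_def by (intro invertible_mult f_invertible iT)
  have X_eq: "X = Q + A\<^sup>H ** T"
    using X_sol by (simp add: is_solution_iff \<phi>_def T_def matrix_mul_assoc)
  have D_eq: "D = W - A\<^sup>H ** T" by (simp add: D_def W_eq X_eq)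
  have fDT: "f D ** T = f P ** T - A"
    by (simp add: D_def f_diff matrix_diff_rdistrib T_def matrix_mul_assoc[symmetric]
        matrix_inv_cancel ifX)
  \<comment> \<open>The relation behind both identities below: it trades \<open>f D\<close> for \<open>D\<close>.\<close>
  have "f P ** (matrix_inv A)\<^sup>H ** D = A - f P ** T"
    unfolding D_eq W_def
    by (simp add: matrix_inv_conj_transpose[OF A, symmetric] matrix_mul_assoc[symmetric]
        matrix_distribs matrix_inv_cancel A ifP invertible_conj_transpose)
  then have key: "f D ** T = - (f P ** (matrix_inv A)\<^sup>H ** D)" by (simp add: fDT)
  have hfP: "(f P)\<^sup>H = f P" using fP by (simp add: pos_def_def hermitian_def)
  have key': "T\<^sup>H ** f D = - (D ** matrix_inv A ** f P)"
    using arg_cong[OF key, of conj_transpose]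
    by (simp add: conj_transpose_simps fDH DH hfP matrix_mul_assoc)
  have I1: "D + T\<^sup>H ** f D ** T = D ** matrix_inv W ** D"
  proof -
    have "T\<^sup>H ** f D ** T = - (D ** matrix_inv A ** (f P ** T))"
      by (simp add: key' matrix_distribs matrix_mul_assoc)
    also have "f P ** T = A - f P ** (matrix_inv A)\<^sup>H ** D"
      using key fDT by (simp add: algebra_simps)
    finally show ?thesis
      by (simp add: W_inv matrix_distribs matrix_mul_assoc[symmetric] matrix_inv_cancel A)
  qed
  have I2: "T\<^sup>H ** (f D ** matrix_inv (f P) ** f D) ** T = D ** matrix_inv W ** D"
  proof -
    have "T\<^sup>H ** (f D ** matrix_inv (f P) ** f D) ** T = (T\<^sup>H ** f D) ** matrix_inv (f P) ** (f D ** T)"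
      by (simp add: matrix_mul_assoc)
    also have "\<dots> = D ** matrix_inv W ** D"
      by (simp add: key key' W_inv matrix_distribs matrix_mul_assoc[symmetric] matrix_inv_cancel ifP)
    finally show ?thesis .
  qed
  have fI1: "f D + (f T)\<^sup>H ** D ** f T = f D ** matrix_inv (f W) ** f D"
    using arg_cong[OF I1, of f] by (simp add: f_add f_mult f_conj_transpose f_f f_matrix_inv iW)
  have fI2: "(f T)\<^sup>H ** E ** f T = f D ** matrix_inv (f W) ** f D"
    using arg_cong[OF I2, of f]
    by (simp add: E_def f_add f_mult f_conj_transpose f_f f_matrix_inv iW ifP)
  obtain K where K: "K > 0" "\<And>x. \<bar>rform P x\<bar> \<le> K * rform Q x"
    using rform_bounded_pos_def[OF Q, of P] by blast
  \<comment> \<open>With this \<open>c\<close>, the bound \<open>c W \<le> P\<close> is a rearrangement of \<open>P \<le> (K + 1) Q\<close>.\<close>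
  define c where "c = (K + 1) / K"
  have c: "c > 1" using K(1) by (simp add: c_def)
  have W_le: "c *\<^sub>R W \<le>\<^sub>L P"
  proof -
    have "c * rform W x \<le> rform P x" for x
    proof -
      have "(K + 1) * rform P x - K * rform P x \<le> (K + 1) * rform Q x"
        using K(2)[of x] pos_def_imp_pos_semidef[OF Q]
        by (simp add: pos_semidef_iff abs_le_iff algebra_simps add_increasing)
      then show ?thesis using K(1) by (simp add: c_def W_eq rform_diff field_simps)
    qed
    then show ?thesis
      using W P by (simp add: loewner_le_iff hermitian_intros pos_def_imp_hermitian rform_scaleR)
  qed
  have inv_le: "c *\<^sub>R matrix_inv S \<le>\<^sub>L matrix_inv R" if "c *\<^sub>R R \<le>\<^sub>L S" "pos_def R" for R S
  proof -
    have "matrix_inv S \<le>\<^sub>L inverse c *\<^sub>R matrix_inv R"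
      using loewner_le_matrix_inv[OF pos_def_scaleR[OF that(2)] that(1)] c
      by (simp add: matrix_inv_scaleR pos_def_imp_invertible that)
    moreover have "pos_def S" using pos_def_mono[OF pos_def_scaleR[OF that(2)] that(1)] c by simp
    ultimately show ?thesis using c that(2) loewner_leD[of "matrix_inv S"]
      by (subst loewner_le_iff)
         (fastforce simp: hermitian_intros pos_def_imp_hermitian pos_def_matrix_inv rform_scaleR field_simps)+
  qed
  have step1: "c * rform E x \<le> rform (D ** matrix_inv W ** D) x" for x
    using loewner_leD[OF inv_le[OF W_le W], of "D *v x"]
      rform_congruence[of D "matrix_inv P" x] rform_congruence[of D "matrix_inv W" x]
    by (simp add: DH E_def rform_scaleR)
  have "c *\<^sub>R f W \<le>\<^sub>L f P"
    using f_mono[OF W_le] by (simp add: f_scaleR_pos_semidef pos_def_imp_pos_semidef W)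
  note f_inv_le = loewner_leD[OF inv_le[OF this f_pos_def[OF W]]]
  have step2: "c * rform (D ** matrix_inv W ** D) x \<le> rform E (U *v x)" for x
  proof -
    have "rform E (U *v x) = rform ((f T)\<^sup>H ** E ** f T) (T *v x)"
      by (simp add: rform_congruence U_def matrix_vector_mul_assoc)
    also have "\<dots> = rform (matrix_inv (f W)) (f D *v (T *v x))"
      unfolding fI2 using rform_congruence[of "f D" "matrix_inv (f W)"] by (simp add: fDH)
    also have "\<dots> \<ge> c * rform (matrix_inv (f P)) (f D *v (T *v x))"
      using f_inv_le by (simp add: rform_scaleR)
    also have "rform (matrix_inv (f P)) (f D *v (T *v x)) = rform (f D ** matrix_inv (f P) ** f D) (T *v x)"
      using rform_congruence[of "f D" "matrix_inv (f P)"] by (simp add: fDH)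
    also have "\<dots> = rform (D ** matrix_inv W ** D) x"
      unfolding I2[symmetric] rform_congruence ..
    finally show ?thesis .
  qed
  have E_nonneg: "0 \<le> rform E x" for x
    using pos_def_imp_pos_semidef[OF pos_def_matrix_inv[OF P]] rform_congruence[of D "matrix_inv P" x]
    by (simp add: E_def DH pos_semidef_iff)
  have DWD_nonneg: "0 \<le> rform (D ** matrix_inv W ** D) x" for x
    using step1[of x] E_nonneg[of x] c by (meson mult_nonneg_nonneg order_trans less_imp_le zero_less_one)
  have E_grow: "c * rform E x \<le> rform E (U *v x)" for x
    using step1[of x] step2[of x] DWD_nonneg[of x] c mult_right_mono[of 1 c, OF _ DWD_nonneg[of x]]
    by simp
  have D_grow: "rform D x \<le> rform D (U *v x)" for x
  proof -
    have "rform D x + rform (f D) (T *v x) = rform (D ** matrix_inv W ** D) x"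
      using arg_cong[OF I1, of "\<lambda>M. rform M x"] by (simp add: rform_add rform_congruence)
    moreover have "rform (f D) (T *v x) + rform D (U *v x) = rform E (U *v x)"
    proof -
      have "f D + (f T)\<^sup>H ** D ** f T = (f T)\<^sup>H ** E ** f T" by (simp add: fI1 fI2)
      from arg_cong[OF this, of "\<lambda>M. rform M (T *v x)"] show ?thesis
        by (simp add: rform_add rform_congruence U_def matrix_vector_mul_assoc)
    qed
    moreover have "rform (D ** matrix_inv W ** D) x \<le> rform E (U *v x)"
      using step2[of x] c mult_right_mono[of 1 c, OF _ DWD_nonneg[of x]] by simp
    ultimately show ?thesis by simp
  qed
  obtain L where L: "L > 0" "\<And>x. \<bar>rform D x\<bar> \<le> L * rform E x"
    unfolding E_def using rform_hermitian_bound_square[OF hD pos_def_matrix_inv[OF P]] by blast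
  have bound: "c ^ n * rform D x \<ge> - (L * rform E x)" for n x
  proof (induction n arbitrary: x)
    case 0
    show ?case using L(2)[of x] by (simp add: abs_le_iff)
  next
    case (Suc n)
    define y where "y = matrix_inv U *v x"
    have x: "x = U *v y" by (simp add: y_def matrix_vector_mul_assoc matrix_inv_cancel iU)
    have "- (L * rform E x) \<le> c * - (L * rform E y)"
      using mult_left_mono[OF E_grow[of y], of L] L(1) by (simp add: x algebra_simps)
    also have "\<dots> \<le> c * (c ^ n * rform D y)"
      using Suc[of y] c by (intro mult_left_mono) auto
    also have "\<dots> \<le> c * (c ^ n * rform D x)"
      using D_grow[of y] c by (intro mult_left_mono) (auto simp: x)
    finally show ?case by (simp add: mult.assoc)
  qed
  have "0 \<le> rform D x" for x
  proof (rule ccontr)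
    assume "\<not> 0 \<le> rform D x"
    then have neg: "rform D x < 0" by simp
    obtain n where "L * rform E x / - rform D x < c ^ n"
      using real_arch_pow[OF c] by blast
    then have "L * rform E x < c ^ n * - rform D x"
      using pos_divide_less_eq[of "- rform D x"] neg by simp
    then show False using bound[of x n] by simp
  qed
  then have "pos_semidef D" using hD by (simp add: pos_semidef_iff)
  then show ?thesis by (simp add: loewner_le_def D_def)
qed

end

section \<open>The recurrence as a discrete flow\<close>

lemma woodbury:
  fixes P R U V :: "'a::real_or_complex^'n^'n"
  assumes P: "invertible P" and R: "invertible R" and S: "invertible (R + V ** matrix_inv P ** U)"
  shows "matrix_inv (P + U ** matrix_inv R ** V) =
    matrix_inv P - matrix_inv P ** U ** matrix_inv (R + V ** matrix_inv P ** U) ** V ** matrix_inv P"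
proof (rule matrix_inv_unique)
  define S' where "S' = R + V ** matrix_inv P ** U"
  have iS: "invertible S'" using S by (simp add: S'_def)
  have "V ** (matrix_inv P ** (U ** Z)) = S' ** Z - R ** Z" for Z :: "'a^'n^'n"
    by (simp add: S'_def matrix_distribs matrix_mul_assoc)
  then show "(P + U ** matrix_inv R ** V) ** (matrix_inv P - matrix_inv P ** U **
      matrix_inv (R + V ** matrix_inv P ** U) ** V ** matrix_inv P) = mat 1"
    unfolding S'_def[symmetric]
    by (simp add: matrix_distribs matrix_mul_assoc[symmetric] matrix_inv_cancel P R iS)
qed

context matrix_equation
begin

lemma f_\<phi>: "pos_def X \<Longrightarrow> f (\<phi> X) = f Q + (f A)\<^sup>H ** matrix_inv X ** f A"
  by (simp add: \<phi>_def f_add f_mult f_conj_transpose f_matrix_inv f_f f_pos_def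
      pos_def_imp_invertible)

text \<open>
By the Woodbury identity the square of \<open>\<phi>\<close> is a matrix Moebius map whose coefficients are the initial
terms \<open>A\<^sup>(\<^sup>1\<^sup>)\<close>, \<open>B\<^sup>(\<^sup>1\<^sup>)\<close>, \<open>Q\<^sup>(\<^sup>1\<^sup>)\<close> of the recurrence.
\<close>

lemma \<phi>_\<phi>:
  assumes X: "pos_def X"
  shows "\<phi> (\<phi> X) = \<phi> Q - (f A ** matrix_inv (f Q) ** A)\<^sup>H
    ** matrix_inv (X + f A ** matrix_inv (f Q) ** (f A)\<^sup>H) ** (f A ** matrix_inv (f Q) ** A)"
proof -
  have fQ: "pos_def (f Q)" by (rule f_pos_def[OF Q])
  have h: "(matrix_inv (f Q))\<^sup>H = matrix_inv (f Q)"
    using pos_def_matrix_inv[OF fQ] by (simp add: pos_def_def hermitian_def)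
  have "pos_semidef (f A ** matrix_inv (f Q) ** (f A)\<^sup>H)"
    using pos_semidef_congruence[OF pos_def_imp_pos_semidef[OF pos_def_matrix_inv[OF fQ]],
      of "(f A)\<^sup>H"] by simp
  then have "invertible (X + f A ** matrix_inv (f Q) ** (f A)\<^sup>H)"
    by (intro pos_def_imp_invertible pos_def_add_pos_semidef X)
  note w = woodbury[OF pos_def_imp_invertible[OF fQ] pos_def_imp_invertible[OF X] this]
  show ?thesis
    unfolding \<phi>_def[of "\<phi> X"] f_\<phi>[OF X] w
    by (simp add: \<phi>_def matrix_distribs conj_transpose_mult h matrix_mul_assoc)
qed

lemma odd_iterate_eq_funpow: "odd_iterate k = ((\<lambda>X. \<phi> (\<phi> X)) ^^ k) (\<phi> Q)"
  by (induction k) (simp_all add: odd_iterate_def even_iterate_def)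

text \<open>
The reflection \<open>X \<mapsto> Q - X\<close> turns solutions into solutions of the equation with \<open>f(A)\<^sup>H\<close> in place of
\<open>A\<close>. Since \<open>f\<close> is an involution that commutes with the conjugate transpose, dualizing twice gives the
original equation back.
\<close>

lemma dual_solution:
  assumes "is_solution f A Q X"
  shows "is_solution f ((f A)\<^sup>H) Q (Q - X)"
proof -
  have ifX: "invertible (f X)" and X: "X = Q + A\<^sup>H ** matrix_inv (f X) ** A"
    using assms by (auto simp: is_solution_iff \<phi>_def)
  have iX: "invertible X" using f_invertible[OF ifX] by (simp add: f_f)
  have ifA: "invertible (f A)" by (rule f_invertible[OF A])
  have iAH: "invertible ((f A)\<^sup>H)" by (rule invertible_conj_transpose[OF ifA])
  have "Q - X = - (A\<^sup>H ** matrix_inv (f X) ** A)" using X by (simp add: algebra_simps)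
  then have fY: "f (Q - X) = - ((f A)\<^sup>H ** matrix_inv X ** f A)"
    by (simp add: f_minus f_mult f_conj_transpose f_matrix_inv ifX f_f)
  have "f (Q - X) ** - (matrix_inv (f A) ** X ** matrix_inv ((f A)\<^sup>H)) = mat 1"
    unfolding fY
    by (simp add: matrix_distribs matrix_mul_assoc[symmetric] matrix_inv_cancel ifA iAH iX)
  then have "invertible (f (Q - X))"
    "matrix_inv (f (Q - X)) = - (matrix_inv (f A) ** X ** matrix_inv ((f A)\<^sup>H))"
    by (auto intro: invertibleI matrix_inv_unique)
  then show ?thesis
    by (simp add: is_solution_def matrix_distribs matrix_mul_assoc[symmetric] matrix_inv_cancel ifA iAH)
qed

lemma dual_equation: "matrix_equation f ((f A)\<^sup>H) Q"
  by unfold_locales (intro invertible_conj_transpose f_invertible A Q)+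

lemma is_dual_solution_iff: "is_dual_solution f A Q Y \<longleftrightarrow> is_solution f ((f A)\<^sup>H) Q Y"
  by (auto simp: is_dual_solution_def is_solution_def algebra_simps)

lemma maximal_pos_def_solutionI:
  assumes "pos_def P" "\<phi> P = P"
  shows "maximal_pos_def_solution (is_solution f A Q) P"
  using assms hermitian_solution_le
  by (simp add: maximal_pos_def_solution_def is_solution_iff pos_def_imp_invertible f_pos_def)

end

text \<open>
The sequences are indexed from 0 here, so \<open>a k\<close>, \<open>b k\<close>, \<open>q k\<close> stand for \<open>A\<^sup>(\<^sup>k\<^sup>+\<^sup>1\<^sup>)\<close>,
\<open>B\<^sup>(\<^sup>k\<^sup>+\<^sup>1\<^sup>)\<close>, \<open>Q\<^sup>(\<^sup>k\<^sup>+\<^sup>1\<^sup>)\<close>.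
\<close>

locale flow_sequence = matrix_equation f A Q
  for f :: "'a::real_or_complex^'n^'n \<Rightarrow> 'a^'n^'n" and A Q +
  fixes a b q :: "nat \<Rightarrow> 'a^'n^'n"
  assumes a_0: "a 0 = f A ** matrix_inv (f Q) ** A"
    and b_0: "b 0 = - (f A ** matrix_inv (f Q) ** (f A)\<^sup>H)"
    and q_0: "q 0 = Q + A\<^sup>H ** matrix_inv (f Q) ** A"
    and a_Suc: "a (Suc k) = a 0 ** matrix_inv (q 0 - b k) ** a k"
    and b_Suc: "b (Suc k) = b 0 + a 0 ** matrix_inv (q 0 - b k) ** (a 0)\<^sup>H"
    and q_Suc: "q (Suc k) = q k - (a k)\<^sup>H ** matrix_inv (q 0 - b k) ** a k"
begin

sublocale dual: matrix_equation f "(f A)\<^sup>H" Q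
  by (rule dual_equation)

lemma q_0_eq: "q 0 = \<phi> Q"
  by (simp add: q_0 \<phi>_def)

lemma \<phi>_\<phi>_eq: "pos_def X \<Longrightarrow> \<phi> (\<phi> X) = q 0 - (a 0)\<^sup>H ** matrix_inv (X - b 0) ** a 0"
  using \<phi>_\<phi>[of X] by (simp add: q_0_eq a_0 b_0)

text \<open>
Apart from initial terms, the recurrence for \<open>b\<close> involves no other sequence: it is the Moebius form of the
squared dual map, read through the reflection \<open>X \<mapsto> Q - X\<close>.
\<close>

lemma dual_odd_iterate_eq: "dual.odd_iterate k = Q - b k"
proof (induction k)
  case 0
  show ?case by (simp add: dual.odd_iterate_def dual.\<phi>_def b_0)
next
  case (Suc k)
  have pd: "pos_def (Q - b k)" using dual.pos_def_odd_iterate[of k] by (simp add: Suc)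
  have h: "(matrix_inv (f Q))\<^sup>H = matrix_inv (f Q)"
    using pos_def_matrix_inv[OF f_pos_def[OF Q]] by (simp add: pos_def_def hermitian_def)
  have a: "f ((f A)\<^sup>H) ** matrix_inv (f Q) ** (f A)\<^sup>H = (a 0)\<^sup>H"
    by (simp add: a_0 f_conj_transpose f_f conj_transpose_mult h matrix_mul_assoc)
  have "dual.odd_iterate (Suc k) = dual.\<phi> (dual.\<phi> (Q - b k))"
    by (simp add: Suc[symmetric] dual.odd_iterate_def dual.even_iterate_Suc)
  also have "\<dots> = dual.\<phi> Q - ((a 0)\<^sup>H)\<^sup>H ** matrix_inv (q 0 - b k) ** (a 0)\<^sup>H"
    unfolding dual.\<phi>_\<phi>[OF pd] a by (simp add: q_0 f_conj_transpose f_f algebra_simps)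
  also have "\<dots> = Q - b (Suc k)"
    by (simp add: dual.\<phi>_def b_Suc b_0)
  finally show ?case .
qed

text \<open>
All matrices that the recurrence inverts are of this kind, since \<open>q 0\<close> lies above \<open>Q\<close>.
\<close>

lemma pos_def_diff_b: "Q \<le>\<^sub>L X \<Longrightarrow> pos_def (X - b k)"
  using pos_def_add_pos_semidef[OF dual.pos_def_odd_iterate[of k], of "X - Q"]
  by (simp add: dual_odd_iterate_eq loewner_le_def)

text \<open>
The matrices \<open>a k\<close>, \<open>b k\<close>, \<open>q k\<close> are the coefficients of the \<open>(k + 1)\<close>-st power of the Moebius map
\<open>\<phi> \<circ> \<phi>\<close>. Composing the map for \<open>k\<close> with one more copy of \<open>\<phi> \<circ> \<phi>\<close> on the inside requires the
inverse of \<open>N - (a 0)\<^sup>H (X - b 0)\<^sup>-\<^sup>1 a 0\<close> with \<open>N = q 0 - b k\<close>, and the Woodbury identity brings it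
into the shape that the recurrence prescribes.
\<close>

lemma funpow_\<phi>_\<phi>_eq:
  assumes "Q \<le>\<^sub>L X"
  shows "((\<lambda>X. \<phi> (\<phi> X)) ^^ Suc k) X = q k - (a k)\<^sup>H ** matrix_inv (X - b k) ** a k"
  using assms
proof (induction k arbitrary: X)
  case 0
  then show ?case by (simp add: \<phi>_\<phi>_eq pos_def_mono[OF Q])
next
  case (Suc k)
  define N where "N = q 0 - b k"
  have X: "pos_def X" using pos_def_mono[OF Q Suc.prems] .
  have "pos_def N" unfolding N_def q_0_eq by (intro pos_def_diff_b Q_le_\<phi> Q)
  then have iN: "invertible N" and hN: "(matrix_inv N)\<^sup>H = matrix_inv N"
    using pos_def_matrix_inv[of N] by (auto simp: pos_def_imp_invertible pos_def_def hermitian_def)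
  have S: "X - b 0 + a 0 ** matrix_inv N ** - ((a 0)\<^sup>H) = X - b (Suc k)"
    by (simp add: b_Suc N_def matrix_distribs)
  have "matrix_inv (N + - ((a 0)\<^sup>H) ** matrix_inv (X - b 0) ** a 0) = matrix_inv N -
      matrix_inv N ** - ((a 0)\<^sup>H) ** matrix_inv (X - b (Suc k)) ** a 0 ** matrix_inv N"
    using woodbury[of N "X - b 0" "a 0" "- ((a 0)\<^sup>H)"] iN
      pos_def_imp_invertible[OF pos_def_diff_b[OF Suc.prems]] unfolding S by blast
  moreover have "N + - ((a 0)\<^sup>H) ** matrix_inv (X - b 0) ** a 0 = \<phi> (\<phi> X) - b k"
    by (simp add: \<phi>_\<phi>_eq[OF X] N_def matrix_distribs)
  ultimately have inv: "matrix_inv (\<phi> (\<phi> X) - b k) = matrix_inv N +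
      matrix_inv N ** (a 0)\<^sup>H ** matrix_inv (X - b (Suc k)) ** a 0 ** matrix_inv N"
    by (simp add: matrix_distribs)
  have "((\<lambda>X. \<phi> (\<phi> X)) ^^ Suc (Suc k)) X = ((\<lambda>X. \<phi> (\<phi> X)) ^^ Suc k) (\<phi> (\<phi> X))"
    by (simp only: funpow_Suc_right o_apply)
  also have "\<dots> = q k - (a k)\<^sup>H ** matrix_inv (\<phi> (\<phi> X) - b k) ** a k"
    by (intro Suc.IH Q_le_\<phi> pos_def_\<phi> X)
  also have "\<dots> = q (Suc k) - (a (Suc k))\<^sup>H ** matrix_inv (X - b (Suc k)) ** a (Suc k)"
    unfolding inv by (simp add: q_Suc a_Suc N_def[symmetric] matrix_distribs conj_transpose_mult hN
        matrix_mul_assoc)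
  finally show ?case .
qed

text \<open>
Evaluating the Moebius map at \<open>X = q 0 = \<phi> Q\<close> produces exactly the right-hand side of the recurrence
for \<open>q\<close>.
\<close>

lemma odd_iterate_eq: "odd_iterate k = q k"
proof (cases k)
  case 0
  then show ?thesis by (simp add: odd_iterate_def q_0_eq)
next
  case (Suc j)
  then show ?thesis
    using funpow_\<phi>_\<phi>_eq[OF Q_le_\<phi>[OF Q], of j] by (simp add: odd_iterate_eq_funpow q_Suc q_0_eq)
qed

section \<open>Limits and extremal solutions\<close>

lemma q_limit:
  obtains X where "q \<longlonglongrightarrow> X" "maximal_pos_def_solution (is_solution f A Q) X"
  using odd_iterate_converges maximal_pos_def_solutionI unfolding odd_iterate_eq[abs_def]
  by blast

text \<open>
The dual sequence converges to the maximal dual solution \<open>Y\<close>, so \<open>b\<close> tends to \<open>Q - Y\<close>. Reflection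
exchanges the Hermitian solutions of the two equations and reverses the order, which turns the maximal
dual solution into the minimal primal one.
\<close>

lemma b_limit:
  obtains B where "b \<longlonglongrightarrow> B" "maximal_pos_def_solution (is_dual_solution f A Q) (Q - B)"
    "minimal_neg_def_solution (is_solution f A Q) B"
proof -
  obtain Y where Y: "dual.odd_iterate \<longlonglongrightarrow> Y" "pos_def Y" "dual.\<phi> Y = Y"
    by (rule dual.odd_iterate_converges)
  have max: "maximal_pos_def_solution (is_solution f ((f A)\<^sup>H) Q) Y"
    by (rule dual.maximal_pos_def_solutionI[OF Y(2,3)])
  have "(\<lambda>k. Q - dual.odd_iterate k) \<longlonglongrightarrow> Q - Y" by (intro tendsto_intros Y)
  then have "b \<longlonglongrightarrow> Q - Y" by (simp add: dual_odd_iterate_eq)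
  moreover have "maximal_pos_def_solution (is_dual_solution f A Q) (Q - (Q - Y))"
    using max by (simp add: is_dual_solution_iff[abs_def])
  moreover have "minimal_neg_def_solution (is_solution f A Q) (Q - Y)"
    unfolding minimal_neg_def_solution_def
  proof (intro conjI allI impI)
    have "Y - Q = ((f A)\<^sup>H)\<^sup>H ** matrix_inv (f Y) ** (f A)\<^sup>H"
      using Y(3) by (simp add: dual.\<phi>_def algebra_simps)
    then show "neg_def (Q - Y)"
      using dual.increment_pos_def[OF Y(2)] by (simp add: neg_def_def)
    show "is_solution f A Q (Q - Y)"
      using dual.dual_solution[of Y] max
      by (simp add: maximal_pos_def_solution_def f_conj_transpose f_f)
    fix X assume X: "hermitian X \<and> is_solution f A Q X"
    then have "Q - X \<le>\<^sub>L Y"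
      using max dual_solution[of X]
      by (simp add: maximal_pos_def_solution_def hermitian_intros pos_def_imp_hermitian Q)
    then show "Q - Y \<le>\<^sub>L X"
      by (simp add: loewner_le_def algebra_simps)
  qed
  ultimately show ?thesis by (rule that)
qed

end

theorem theorem2p2:
  fixes f :: "'a::real_or_complex ^ 'n::finite ^ 'n \<Rightarrow> 'a ^ 'n ^ 'n"
    and A Q :: "'a ^ 'n ^ 'n"
    and As Bs Qs :: "nat \<Rightarrow> 'a ^ 'n ^ 'n"
  assumes a1: "\<And>M. f (f M) = M"
    and a2: "\<And>M N. f (M + N) = f M + f N"
    and a3: "\<And>M N. f (M ** N) = f M ** f N"
    and a4: "\<And>M. pos_semidef M \<Longrightarrow> pos_semidef (f M)"
    and f_into: "\<And>M. pos_def M \<Longrightarrow> pos_def (f M)"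
    and f_cont: "continuous_on {M. pos_def M} f"
    and A: "invertible A"
    and Q: "pos_def Q"
    and A_1: "As 1 = f A ** matrix_inv (f Q) ** A"
    and B_1: "Bs 1 = - (f A ** matrix_inv (f Q) ** (f A)\<^sup>H)"
    and Q_1: "Qs 1 = Q + A\<^sup>H ** matrix_inv (f Q) ** A"
    and A_k: "\<And>k. k > 1 \<Longrightarrow> As k = As 1 ** matrix_inv (Qs 1 - Bs (k - 1)) ** As (k - 1)"
    and B_k: "\<And>k. k > 1 \<Longrightarrow> Bs k = Bs 1 + As 1 ** matrix_inv (Qs 1 - Bs (k - 1)) ** (As 1)\<^sup>H"
    and Q_k: "\<And>k. k > 1 \<Longrightarrow>
      Qs k = Qs (k - 1) - (As (k - 1))\<^sup>H ** matrix_inv (Qs 1 - Bs (k - 1)) ** As (k - 1)"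
  shows "(convergent Qs \<and> maximal_pos_def_solution (is_solution f A Q) (lim Qs)) \<and>
    (convergent Bs \<and> maximal_pos_def_solution (is_dual_solution f A Q) (Q - lim Bs)) \<and>
    minimal_neg_def_solution (is_solution f A Q) (lim Bs)"
proof -
  interpret flow_sequence f A Q "\<lambda>k. As (Suc k)" "\<lambda>k. Bs (Suc k)" "\<lambda>k. Qs (Suc k)"
  proof
    fix k
    show "As (Suc (Suc k)) = As (Suc 0) ** matrix_inv (Qs (Suc 0) - Bs (Suc k)) ** As (Suc k)"
      using A_k[of "Suc (Suc k)"] by simp
    show "Bs (Suc (Suc k)) = Bs (Suc 0)
        + As (Suc 0) ** matrix_inv (Qs (Suc 0) - Bs (Suc k)) ** (As (Suc 0))\<^sup>H"
      using B_k[of "Suc (Suc k)"] by simp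
    show "Qs (Suc (Suc k)) = Qs (Suc k)
        - (As (Suc k))\<^sup>H ** matrix_inv (Qs (Suc 0) - Bs (Suc k)) ** As (Suc k)"
      using Q_k[of "Suc (Suc k)"] by simp
  qed (use a1 a2 a3 a4 f_into A Q A_1 B_1 Q_1 in simp_all)
  obtain X where X: "(\<lambda>k. Qs (Suc k)) \<longlonglongrightarrow> X" "maximal_pos_def_solution (is_solution f A Q) X"
    by (rule q_limit)
  obtain B where B: "(\<lambda>k. Bs (Suc k)) \<longlonglongrightarrow> B"
      "maximal_pos_def_solution (is_dual_solution f A Q) (Q - B)"
      "minimal_neg_def_solution (is_solution f A Q) B"
    by (rule b_limit)
  have "Qs \<longlonglongrightarrow> X" "Bs \<longlonglongrightarrow> B" using X(1) B(1) LIMSEQ_imp_Suc by blast+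
  with X(2) B(2,3) show ?thesis by (auto simp: limI convergent_def)
qed

end
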